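(* Fix $\alpha\in(0,\infty)$ and $n\in\mathbb N$. Let $\mathcal P$ be a nonempty convex set of probability measures on a measurable space $(\mathcal X,\mathcal F)$ that is dominated by a $\sigma$-finite measure, and let $\theta:\mathcal P\to\mathbb R$ be linear (i.e. $\theta(\lambda P_0+(1-\lambda)P_1)=\lambda\theta(P_0)+(1-\lambda)\theta(P_1)$ for $P_0,P_1\in\mathcal P$, $\lambda\in[0,1]$) and bounded, $\sup_{P\in\mathcal P}|\theta(P)|<\infty$. Let $l:[0,\infty)\to[0,\infty)$ be non-decreasing with $l(0)=0$ and $l(\frac32t)\le a\,l(t)$ for all $t\ge0$, for some $a\in(1,\infty)$. Then there exist a function $\ell^*\in L_\infty(\mathcal X)$ and a constant $b\in\mathbb R$ such that $$\sup_{P\in\mathcal P}\mathbb E_{[Q_1^{(\alpha,\ell^* )}P]^{\otimes n}}\left[l\left(\left|\Pi\left[\bar Z_n+b\right]-\theta(P)\right|\right)\right]\;\le\; C_2\cdot l\left(\omega_{TV}\left(\frac{4}{\sqrt n}\,\frac{e^\alpha+1}{e^\alpha-1}\right)\right),$$ where $\Pi:\mathbb R\to[M_-,M_+]$ is the projection onto the closure $[M_-,M_+]$ of the range $\theta(\mathcal P)$ (which is an interval), $\bar Z_n=\frac1n\sum_{i=1}^nZ_i$ is the sample mean of the observations $Z_1,\dots,Z_n$, which are iid with law $Q_1^{(\alpha,\ell^* )}P$, and $$C_2=\left[2+a^2+\frac{8a^2}{2a-1}\right]a^{\lceil 2\log(C)/\log(3/2)\rceil+3},\qquad C=\sqrt{\tfrac32}\left[\max\{8(e^\alpha+1),\sqrt{2\log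 2a}+1\}+1\right].$$
   Context: $L_\infty(\mathcal X)$ is the set of bounded measurable functions $\ell:\mathcal X\to\mathbb R$ with supremum norm $\|\ell\|_\infty$. Binary channel: with $z_0=\|\ell\|_\infty\frac{e^\alpha+1}{e^\alpha-1}$, $Q_1^{(\alpha,\ell)}$ is the Markov kernel from $\mathcal X$ to $\{-z_0,z_0\}\subset\mathbb R$ given by $Q_1^{(\alpha,\ell)}(\{\pm z_0\}|x)=\frac12\big(1\pm\frac{\ell(x)}{z_0}\big)$ (for $\ell\equiv0$ it is the point mass at $0$ for every $x$). $Q_1P(A)=\int Q_1(A|x)\,dP(x)$. $\omega_{TV}(\varepsilon)=\sup\{|\theta(P_0)-\theta(P_1)|:d_{TV}(P_0,P_1)\le\varepsilon,\ P_0,P_1\in\mathcal P\}$ with $d_{TV}(P_0,P_1)=\sup_A|P_0(A)-P_1(A)|$. *)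

theory Defs
  imports "HOL-Probability.Probability"
begin

section \<open>Convex sets of probability measures and linear functionals\<close>

definition mix_measure :: "real \<Rightarrow> 'a measure \<Rightarrow> 'a measure \<Rightarrow> 'a measure" where
  "mix_measure c P0 P1 = measure_of (space P0) (sets P0)
     (\<lambda>A. ennreal c * emeasure P0 A + ennreal (1 - c) * emeasure P1 A)"

lemma sets_mix_measure [simp]: "sets (mix_measure c P0 P1) = sets P0"
  by (simp add: mix_measure_def)

lemma emeasure_mix_measure:
  assumes "sets P1 = sets P0" and "A \<in> sets P0"
  shows "emeasure (mix_measure c P0 P1) A
           = ennreal c * emeasure P0 A + ennreal (1 - c) * emeasure P1 A"
proof (rule emeasure_measure_of[OF mix_measure_def])
  show "countably_additive (sets (mix_measure c P0 P1))
          (\<lambda>A. ennreal c * emeasure P0 A + ennreal (1 - c) * emeasure P1 A)"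
    using assms(1)
    by (intro countably_additiveI)
       (simp add: suminf_add[symmetric] ennreal_suminf_cmult suminf_emeasure)
qed (use assms sets.space_closed in \<open>auto simp: positive_def\<close>)

definition convex_measures :: "'a measure set \<Rightarrow> bool" where
  "convex_measures \<P> \<longleftrightarrow>
     (\<forall>P0\<in>\<P>. \<forall>P1\<in>\<P>. \<forall>c\<in>{0..1}. mix_measure c P0 P1 \<in> \<P>)"

definition linear_functional_on :: "'a measure set \<Rightarrow> ('a measure \<Rightarrow> real) \<Rightarrow> bool" where
  "linear_functional_on \<P> \<theta> \<longleftrightarrow>
     (\<forall>P0\<in>\<P>. \<forall>P1\<in>\<P>. \<forall>c\<in>{0..1}. \<theta> (mix_measure c P0 P1) = c * \<theta> P0 + (1 - c) * \<theta> P1)"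

definition dominated_on :: "'a measure \<Rightarrow> 'a measure set \<Rightarrow> bool" where
  "dominated_on M \<P> \<longleftrightarrow>
     (\<exists>\<mu>. sigma_finite_measure \<mu> \<and> sets \<mu> = sets M \<and> (\<forall>P\<in>\<P>. absolutely_continuous \<mu> P))"

section \<open>Total variation and its modulus of continuity\<close>

text \<open>
  Both suprema are over nonempty bounded sets of reals in the intended setting (probability measures
  on a common sigma-algebra, \<open>\<theta>\<close> bounded on a nonempty \<open>\<P>\<close>, \<open>\<epsilon> \<ge> 0\<close>).
\<close>

definition d_TV :: "'a measure \<Rightarrow> 'a measure \<Rightarrow> real" where
  "d_TV P0 P1 = (SUP A\<in>sets P0. \<bar>measure P0 A - measure P1 A\<bar>)"

definition omega_TV :: "'a measure set \<Rightarrow> ('a measure \<Rightarrow> real) \<Rightarrow> real \<Rightarrow> real" where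
  "omega_TV \<P> \<theta> \<epsilon> = Sup {\<bar>\<theta> P0 - \<theta> P1\<bar> | P0 P1. P0 \<in> \<P> \<and> P1 \<in> \<P> \<and> d_TV P0 P1 \<le> \<epsilon>}"

section \<open>The binary channel\<close>

definition L_infty :: "'a measure \<Rightarrow> ('a \<Rightarrow> real) set" where
  "L_infty M = {l \<in> borel_measurable M. bounded (l ` space M)}"

text \<open>The supremum norm is a genuine pointwise supremum, not an essential one.\<close>

definition sup_norm :: "'a measure \<Rightarrow> ('a \<Rightarrow> real) \<Rightarrow> real" where
  "sup_norm M l = (SUP x\<in>space M. \<bar>l x\<bar>)"

definition z0 :: "'a measure \<Rightarrow> real \<Rightarrow> ('a \<Rightarrow> real) \<Rightarrow> real" where
  "z0 M \<alpha> l = sup_norm M l * (exp \<alpha> + 1) / (exp \<alpha> - 1)"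

text \<open>
  The kernel takes values in the Borel measures on the reals so that its two support points can be
  averaged. \<open>bernoulli_pmf\<close> clamps its argument to \<open>[0, 1]\<close>; the lemma \<open>Q1_weight_bounds\<close> below shows
  that the clamping is vacuous on \<open>space M\<close>.
\<close>

definition Q1 :: "'a measure \<Rightarrow> real \<Rightarrow> ('a \<Rightarrow> real) \<Rightarrow> 'a \<Rightarrow> real measure" where
  "Q1 M \<alpha> l x =
     (if sup_norm M l = 0 then return borel 0
      else distr (measure_pmf (bernoulli_pmf (1 / 2 * (1 + l x / z0 M \<alpha> l)))) borel
             (\<lambda>s. if s then z0 M \<alpha> l else - z0 M \<alpha> l))"

lemma space_Q1 [simp]: "space (Q1 M \<alpha> l x) = UNIV"
  and sets_Q1 [simp, measurable_cong]: "sets (Q1 M \<alpha> l x) = sets borel"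
  by (simp_all add: Q1_def)

lemma prob_space_Q1: "prob_space (Q1 M \<alpha> l x)"
  by (auto simp: Q1_def intro!: prob_space_return prob_space.prob_space_distr
      measure_pmf.prob_space_axioms)

lemma abs_le_sup_norm:
  assumes "l \<in> L_infty M" "x \<in> space M"
  shows "\<bar>l x\<bar> \<le> sup_norm M l"
proof -
  have "bdd_above ((\<lambda>x. \<bar>l x\<bar>) ` space M)"
    using assms(1) by (auto simp: L_infty_def bounded_iff bdd_above_def)
  with assms(2) show ?thesis
    unfolding sup_norm_def by (rule cSUP_upper)
qed

lemma Q1_weight_bounds:
  assumes "\<alpha> > 0" "l \<in> L_infty M" "x \<in> space M"
  shows "1 / 2 * (1 + l x / z0 M \<alpha> l) \<in> {0..1}"
proof -
  have "0 \<le> sup_norm M l"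
    using abs_le_sup_norm[OF assms(2,3)] by linarith
  then have "sup_norm M l * 1 \<le> sup_norm M l * ((exp \<alpha> + 1) / (exp \<alpha> - 1))"
    using assms(1) by (intro mult_left_mono) (simp_all add: field_simps)
  then have le: "\<bar>l x\<bar> \<le> z0 M \<alpha> l"
    using abs_le_sup_norm[OF assms(2,3)] by (simp add: z0_def)
  then have "\<bar>l x / z0 M \<alpha> l\<bar> \<le> 1"
    by (cases "z0 M \<alpha> l = 0") (auto simp: abs_divide divide_le_eq)
  then have "- 1 \<le> l x / z0 M \<alpha> l" "l x / z0 M \<alpha> l \<le> 1"
    unfolding abs_le_iff by linarith+
  then show ?thesis by simp
qed

lemma emeasure_Q1:
  assumes "\<alpha> > 0" "l \<in> L_infty M" "x \<in> space M" "sup_norm M l \<noteq> 0" "A \<in> sets borel"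
  shows "emeasure (Q1 M \<alpha> l x) A =
    ennreal (1 / 2 * (1 + l x / z0 M \<alpha> l)) * indicator A (z0 M \<alpha> l)
    + ennreal (1 / 2 * (1 - l x / z0 M \<alpha> l)) * indicator A (- z0 M \<alpha> l)"
proof -
  let ?p = "1 / 2 * (1 + l x / z0 M \<alpha> l)"
  let ?f = "\<lambda>s. if s then z0 M \<alpha> l else - z0 M \<alpha> l"
  have p: "0 \<le> ?p" "?p \<le> 1" using Q1_weight_bounds[OF assms(1-3)] by auto
  have "emeasure (Q1 M \<alpha> l x) A = emeasure (measure_pmf (bernoulli_pmf ?p)) (?f -` A)"
    using assms(4,5) by (simp add: Q1_def emeasure_distr)
  also have "\<dots> = (\<integral>\<^sup>+s. indicator (?f -` A) s \<partial>measure_pmf (bernoulli_pmf ?p))"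
    by (rule nn_integral_indicator[symmetric]) simp
  also have "\<dots> = (\<integral>\<^sup>+s. indicator A (?f s) \<partial>measure_pmf (bernoulli_pmf ?p))"
    by (intro nn_integral_cong) (simp add: indicator_def)
  also have "\<dots> = ennreal ?p * indicator A (z0 M \<alpha> l)
      + ennreal (1 - ?p) * indicator A (- z0 M \<alpha> l)"
    using p by (simp add: mult.commute)
  also have "1 - ?p = 1 / 2 * (1 - l x / z0 M \<alpha> l)" by (simp add: field_simps)
  finally show ?thesis .
qed

lemma measurable_Q1 [measurable (raw)]:
  assumes "\<alpha> > 0" "l \<in> L_infty M"
  shows "Q1 M \<alpha> l \<in> measurable M (subprob_algebra borel)"
proof (cases "sup_norm M l = 0")
  case True
  then show ?thesis by (simp add: Q1_def[abs_def])
next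
  case False
  have l [measurable]: "l \<in> borel_measurable M" using assms(2) by (simp add: L_infty_def)
  show ?thesis
  proof (rule measurable_subprob_algebra)
    show "subprob_space (Q1 M \<alpha> l x)" for x
      by (simp add: prob_space_Q1 prob_space_imp_subprob_space)
    show "(\<lambda>x. emeasure (Q1 M \<alpha> l x) A) \<in> borel_measurable M" if "A \<in> sets borel" for A
      by (subst measurable_cong[OF emeasure_Q1[OF assms _ False that]]) measurable
  qed simp
qed

text \<open>
  \<open>P \<bind> Q1 M \<alpha> l\<close> is the law \<open>Q\<^sub>1P\<close> of a single privatized observation.
\<close>

lemma emeasure_bind_Q1:
  assumes "\<alpha> > 0" "l \<in> L_infty M" "P \<in> space (prob_algebra M)" "A \<in> sets borel"
  shows "emeasure (P \<bind> Q1 M \<alpha> l) A = (\<integral>\<^sup>+x. emeasure (Q1 M \<alpha> l x) A \<partial>P)"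
proof -
  have P: "sets P = sets M" "prob_space P"
    using assms(3) by (auto simp: space_prob_algebra)
  have "Q1 M \<alpha> l \<in> measurable P (subprob_algebra borel)"
    using measurable_Q1[OF assms(1,2)] by (simp add: measurable_cong_sets[OF P(1) refl])
  then show ?thesis
    using P(2) assms(4) by (intro emeasure_bind) (auto simp: prob_space.not_empty)
qed

section \<open>The risk of the projected sample mean\<close>

text \<open>\<open>closest_point\<close> onto the closure of the range of \<open>\<theta>\<close> is the projection \<open>\<Pi>\<close>.\<close>

definition mean_estimator ::
  "'a measure set \<Rightarrow> ('a measure \<Rightarrow> real) \<Rightarrow> nat \<Rightarrow> real \<Rightarrow> (nat \<Rightarrow> real) \<Rightarrow> real" where
  "mean_estimator \<P> \<theta> n b Z =
     closest_point (closure (\<theta> ` \<P>)) ((\<Sum>i<n. Z i) / real n + b)"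

definition C_const :: "real \<Rightarrow> real \<Rightarrow> real" where
  "C_const \<alpha> a = sqrt (3 / 2) * (max (8 * (exp \<alpha> + 1)) (sqrt (2 * ln (2 * a)) + 1) + 1)"

definition C2_const :: "real \<Rightarrow> real \<Rightarrow> real" where
  "C2_const \<alpha> a = (2 + a\<^sup>2 + 8 * a\<^sup>2 / (2 * a - 1))
     * a powi (\<lceil>2 * ln (C_const \<alpha> a) / ln (3 / 2)\<rceil> + 3)"

end

theory Submission
  imports Defs
begin

text \<open>
  Write \<open>\<omega>\<close> for the modulus at \<open>\<epsilon> = 4 \<kappa> / sqrt n\<close> with \<open>\<kappa> = (exp \<alpha> + 1) / (exp \<alpha> - 1)\<close>, and let
  \<open>K = \<omega> / (2 \<epsilon>)\<close>. Convexity makes the modulus grow at most linearly beyond \<open>\<epsilon>\<close>, so for each pair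
  \<open>P, Q\<close> some test function \<open>l\<close> with \<open>\<bar>l\<bar> \<le> K\<close> satisfies \<open>\<theta> P - \<theta> Q - (\<integral>l dP - \<integral>l dQ) \<le> \<omega>\<close>. A minimax
  argument yields one \<open>l\<close> that works for all pairs up to another \<open>\<omega>\<close>, hence an affine
  functional \<open>\<integral>l dP + b\<close> within \<open>\<omega>\<close> of \<open>\<theta>\<close>.

  The minimax step avoids weak-star compactness: adding a penalty \<open>\<eta> \<integral>l\<^sup>2\<close> makes the payoff strongly
  convex in \<open>l\<close>, with an explicit pointwise best reply to each pair. Along a sequence of pairs that
  maximises the value, the best replies converge almost everywhere, and their limit is optimal.

  The channel has range \<open>\<plusminus>z\<^sub>0\<close> with \<open>z\<^sub>0 \<le> K \<kappa> = \<omega> sqrt n / 8\<close>, so by Hoeffding's lemma the deviation of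
  the sample mean in units of \<open>\<omega>\<close> has exponential moment at most \<open>2 exp (1/128)\<close>; the doubling condition
  bounds the loss by an exponential of that deviation.
\<close>

section \<open>A minimax theorem with explicit best replies\<close>

text \<open>Weighting the squares by \<open>2 ^ j\<close> still leaves integrals with a finite sum,
  so the weighted series converges almost everywhere; \<open>\<bar>u j x\<bar> \<le> (1 / 2) ^ j + 2
  ^ j * (u j x)\<^sup>2\<close> then removes the squares.\<close>

lemma AE_summable_of_integral_power2_le:
  fixes u :: "nat \<Rightarrow> 'a \<Rightarrow> real"
  assumes u [measurable]: "\<And>j. u j \<in> borel_measurable M"
    and int: "\<And>j. integrable M (\<lambda>x. (u j x)\<^sup>2)"
    and le: "\<And>j. (\<integral>x. (u j x)\<^sup>2 \<partial>M) \<le> B * (1 / 4) ^ j"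
  shows "AE x in M. summable (\<lambda>j. \<bar>u j x\<bar>)"
proof -
  have "0 \<le> (\<integral>x. (u 0 x)\<^sup>2 \<partial>M)" by (rule Bochner_Integration.integral_nonneg) simp
  also have "\<dots> \<le> B" using le[of 0] by simp
  finally have B: "B \<ge> 0" .
  have "(\<integral>\<^sup>+x. (\<Sum>j. ennreal (2 ^ j * (u j x)\<^sup>2)) \<partial>M)
      = (\<Sum>j. \<integral>\<^sup>+x. ennreal (2 ^ j * (u j x)\<^sup>2) \<partial>M)"
    by (rule nn_integral_suminf) simp
  also have "\<dots> = (\<Sum>j. ennreal (2 ^ j * (\<integral>x. (u j x)\<^sup>2 \<partial>M)))"
    using int by (subst nn_integral_eq_integral) simp_all
  also have "\<dots> \<le> (\<Sum>j. ennreal (B * (1 / 2) ^ j))"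
  proof (intro suminf_le ennreal_leI)
    fix j
    have "2 ^ j * (\<integral>x. (u j x)\<^sup>2 \<partial>M) \<le> 2 ^ j * (B * (1 / 4) ^ j)"
      using le by (intro mult_left_mono) simp_all
    also have "\<dots> = B * (2 * (1 / 4)) ^ j" unfolding power_mult_distrib by (rule mult.left_commute)
    also have "\<dots> = B * (1 / 2) ^ j" by simp
    finally show "2 ^ j * (\<integral>x. (u j x)\<^sup>2 \<partial>M) \<le> B * (1 / 2) ^ j" .
  qed auto
  also have "\<dots> = ennreal (\<Sum>j. B * (1 / 2) ^ j)"
    using B by (intro suminf_ennreal2 summable_mult summable_geometric) simp_all
  also have "\<dots> < \<infinity>" by simp
  finally have "AE x in M. (\<Sum>j. ennreal (2 ^ j * (u j x)\<^sup>2)) \<noteq> \<infinity>"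
    by (intro nn_integral_PInf_AE) auto
  then show ?thesis
  proof eventually_elim
    case (elim x)
    then have "summable (\<lambda>j. 2 ^ j * (u j x)\<^sup>2)"
      by (intro summable_suminf_not_top) simp_all
    then have "summable (\<lambda>j. (1 / 2) ^ j + 2 ^ j * (u j x)\<^sup>2)"
      by (intro summable_add) (auto simp: summable_geometric)
    then show ?case
    proof (rule summable_comparison_test'[where N = 0])
      fix j
      have "\<bar>u j x\<bar> * 1 \<le> (1 / 2) ^ j + 2 ^ j * (u j x)\<^sup>2"
      proof -
        define s :: real where "s = 2 ^ j"
        have s: "s > 0" by (simp add: s_def)
        have "0 \<le> (1 - s * \<bar>u j x\<bar>)\<^sup>2" by simp
        also have "\<dots> = 1 - 2 * s * \<bar>u j x\<bar> + s * (s * \<bar>u j x\<bar>\<^sup>2)"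
          by (simp add: power2_eq_square algebra_simps)
        finally have "s * (2 * \<bar>u j x\<bar>) \<le> s * (1 / s + s * (u j x)\<^sup>2)"
          using s by (simp add: algebra_simps)
        with s have "2 * \<bar>u j x\<bar> \<le> 1 / s + s * (u j x)\<^sup>2" by simp
        then show ?thesis by (simp add: s_def power_divide)
      qed
      then show "norm \<bar>u j x\<bar> \<le> (1 / 2) ^ j + 2 ^ j * (u j x)\<^sup>2" by simp
    qed
  qed
qed

text \<open>The weight \<open>t\<close> sits on the second argument, so a small \<open>t\<close>
  perturbs the first; \<open>mix_measure\<close> puts its weight on the first argument
  instead.\<close>

definition mix_pair :: "real \<Rightarrow> real \<times> ('a \<Rightarrow> real) \<Rightarrow> real \<times> ('a \<Rightarrow> real) \<Rightarrow> real \<times> ('a \<Rightarrow> real)" where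
  "mix_pair t s s' = ((1 - t) * fst s + t * fst s', \<lambda>x. (1 - t) * snd s x + t * snd s' x)"

text \<open>
  A pair \<open>(c, g)\<close> stands for the affine payoff \<open>c - \<integral> l g\<close> against the test function \<open>l\<close>; later \<open>c\<close> is
  \<open>\<theta> P - \<theta> Q\<close> and \<open>g\<close> is the difference of the densities of \<open>P\<close> and \<open>Q\<close>.
\<close>

locale penalised_game = finite_measure \<nu>
  for \<nu> :: "'a measure" +
  fixes S :: "(real \<times> ('a \<Rightarrow> real)) set" and K V \<eta> :: real
  assumes S_nonempty: "S \<noteq> {}" and K_nonneg: "K \<ge> 0" and eta_pos: "\<eta> > 0"
    and integ: "s \<in> S \<Longrightarrow> integrable \<nu> (snd s)"
    and mix_closed: "\<lbrakk>s \<in> S; s' \<in> S; 0 \<le> t; t \<le> 1\<rbrakk> \<Longrightarrow> mix_pair t s s' \<in> S"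
    and value_le: "s \<in> S \<Longrightarrow> \<exists>l \<in> borel_measurable \<nu>. (\<forall>x. \<bar>l x\<bar> \<le> K) \<and>
          fst s - (\<integral>x. l x * snd s x \<partial>\<nu>) \<le> V"
begin

section \<open>Strategies, payoffs and best replies\<close>

definition strategies :: "('a \<Rightarrow> real) set" where
  "strategies = {l \<in> borel_measurable \<nu>. \<forall>x. \<bar>l x\<bar> \<le> K}"

definition payoff :: "real \<times> ('a \<Rightarrow> real) \<Rightarrow> ('a \<Rightarrow> real) \<Rightarrow> real" where
  "payoff s l = fst s - (\<integral>x. l x * snd s x \<partial>\<nu>) + \<eta> * (\<integral>x. (l x)\<^sup>2 \<partial>\<nu>)"

text \<open>Pointwise minimiser of \<open>\<eta> * y\<^sup>2 - y * snd s x\<close> over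
  \<open>y\<close> in \<open>[- K, K]\<close>.\<close>

definition reply :: "real \<times> ('a \<Rightarrow> real) \<Rightarrow> 'a \<Rightarrow> real" where
  "reply s x = max (- K) (min K (snd s x / (2 * \<eta>)))"

text \<open>By \<open>payoff_reply_le\<close>, each \<open>payoff s (reply s)\<close> is a minimum
  over strategies, so this is the sup-inf value of the penalised game.\<close>

definition game_value :: real where
  "game_value = (SUP s\<in>S. payoff s (reply s))"

lemma strategiesD [measurable_dest]: "l \<in> strategies \<Longrightarrow> l \<in> borel_measurable \<nu>"
  and strategies_bound: "l \<in> strategies \<Longrightarrow> \<bar>l x\<bar> \<le> K"
  by (auto simp: strategies_def)

lemma borel_S: "s \<in> S \<Longrightarrow> snd s \<in> borel_measurable \<nu>"
  using integ by blast

lemma reply_strategies: "s \<in> S \<Longrightarrow> reply s \<in> strategies"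
  using borel_S[of s] K_nonneg by (auto simp: strategies_def reply_def[abs_def] abs_le_iff)

lemma integrable_mult_strategy:
  assumes "s \<in> S" "l \<in> strategies"
  shows "integrable \<nu> (\<lambda>x. l x * snd s x)"
proof (rule Bochner_Integration.integrable_bound[of _ "\<lambda>x. K * \<bar>snd s x\<bar>"])
  show "integrable \<nu> (\<lambda>x. K * \<bar>snd s x\<bar>)" using integ[OF assms(1)] by simp
  show "AE x in \<nu>. norm (l x * snd s x) \<le> norm (K * \<bar>snd s x\<bar>)"
    using strategies_bound[OF assms(2)] K_nonneg by (auto simp: abs_mult intro!: mult_right_mono)
qed (use assms borel_S in measurable)

lemma integrable_power2_strategy:
  assumes "l \<in> strategies"
  shows "integrable \<nu> (\<lambda>x. (l x)\<^sup>2)"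
proof (rule integrable_const_bound[of _ "K\<^sup>2"])
  show "AE x in \<nu>. norm ((l x)\<^sup>2) \<le> K\<^sup>2"
    using strategies_bound[OF assms] by (auto simp: power2_le_iff_abs_le K_nonneg)
qed (use assms in measurable)

lemma integrable_power2_diff_strategy:
  assumes "l \<in> strategies" "k \<in> strategies"
  shows "integrable \<nu> (\<lambda>x. (l x - k x)\<^sup>2)"
proof (rule integrable_const_bound[of _ "(2 * K)\<^sup>2"])
  show "AE x in \<nu>. norm ((l x - k x)\<^sup>2) \<le> (2 * K)\<^sup>2"
  proof (rule AE_I2)
    fix x
    have "\<bar>l x - k x\<bar> \<le> 2 * K"
      using strategies_bound[OF assms(1), of x] strategies_bound[OF assms(2), of x] by linarith
    then have "(l x - k x)\<^sup>2 \<le> (2 * K)\<^sup>2"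
      using K_nonneg by (subst power2_le_iff_abs_le) auto
    then show "norm ((l x - k x)\<^sup>2) \<le> (2 * K)\<^sup>2" by simp
  qed
qed (use assms in measurable)

text \<open>
  Completing the square reduces this to \<open>(l - reply s) (2 \<eta> reply s - snd s) \<ge> 0\<close>, which holds
  pointwise because \<open>reply s\<close> is the truncation of the unconstrained minimiser.
\<close>

lemma payoff_reply_le:
  assumes "s \<in> S" "l \<in> strategies"
  shows "payoff s (reply s) + \<eta> * (\<integral>x. (l x - reply s x)\<^sup>2 \<partial>\<nu>) \<le> payoff s l"
proof -
  let ?k = "reply s"
  have k: "?k \<in> strategies" using reply_strategies assms by blast
  note [simp] = integrable_mult_strategy[OF assms] integrable_mult_strategy[OF assms(1) k]
    integrable_power2_strategy[OF assms(2)] integrable_power2_strategy[OF k]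
    integrable_power2_diff_strategy[OF assms(2) k]
  have "0 \<le> (\<integral>x. (l x - ?k x) * (2 * \<eta> * ?k x - snd s x) \<partial>\<nu>)"
  proof (rule Bochner_Integration.integral_nonneg)
    fix x
    have l: "- K \<le> l x" "l x \<le> K" using strategies_bound[OF assms(2), of x] by auto
    consider "snd s x / (2 * \<eta>) > K" | "snd s x / (2 * \<eta>) < - K"
      | "- K \<le> snd s x / (2 * \<eta>)" "snd s x / (2 * \<eta>) \<le> K" by linarith
    then show "0 \<le> (l x - ?k x) * (2 * \<eta> * ?k x - snd s x)"
    proof cases
      case 1
      then have k: "?k x = K" using K_nonneg by (simp add: reply_def)
      have "2 * \<eta> * K \<le> snd s x" using 1 eta_pos by (simp add: field_simps)
      then show ?thesis unfolding k using l by (intro mult_nonpos_nonpos) auto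
    next
      case 2
      then have k: "?k x = - K" using K_nonneg by (simp add: reply_def)
      have "2 * \<eta> * (- K) \<ge> snd s x" using 2 eta_pos by (simp add: field_simps)
      then show ?thesis unfolding k using l by (intro mult_nonneg_nonneg) auto
    next
      case 3
      then have k: "?k x = snd s x / (2 * \<eta>)" by (simp add: reply_def)
      then show ?thesis using eta_pos by simp
    qed
  qed
  also have "\<dots> = (\<integral>x. ?k x * snd s x - l x * snd s x
        + \<eta> * ((l x)\<^sup>2 - (?k x)\<^sup>2 - (l x - ?k x)\<^sup>2) \<partial>\<nu>)"
    by (intro Bochner_Integration.integral_cong) (auto simp: power2_eq_square algebra_simps)
  also have "\<dots> = (\<integral>x. ?k x * snd s x \<partial>\<nu>) - (\<integral>x. l x * snd s x \<partial>\<nu>)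
        + \<eta> * ((\<integral>x. (l x)\<^sup>2 \<partial>\<nu>) - (\<integral>x. (?k x)\<^sup>2 \<partial>\<nu>) - (\<integral>x. (l x - ?k x)\<^sup>2 \<partial>\<nu>))"
    by simp
  also have "\<dots> = payoff s l - payoff s ?k - \<eta> * (\<integral>x. (l x - ?k x)\<^sup>2 \<partial>\<nu>)"
    by (simp add: payoff_def algebra_simps)
  finally show ?thesis by simp
qed

lemma payoff_mix_pair:
  assumes "s \<in> S" "s' \<in> S" "l \<in> strategies"
  shows "payoff (mix_pair t s s') l = (1 - t) * payoff s l + t * payoff s' l"
proof -
  note [simp] = integrable_mult_strategy[OF assms(1,3)] integrable_mult_strategy[OF assms(2,3)]
  have "(\<integral>x. l x * ((1 - t) * snd s x + t * snd s' x) \<partial>\<nu>)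
      = (\<integral>x. (1 - t) * (l x * snd s x) + t * (l x * snd s' x) \<partial>\<nu>)"
    by (intro Bochner_Integration.integral_cong) (auto simp: algebra_simps)
  also have "\<dots> = (1 - t) * (\<integral>x. l x * snd s x \<partial>\<nu>) + t * (\<integral>x. l x * snd s' x \<partial>\<nu>)"
    by (subst Bochner_Integration.integral_add) simp_all
  finally show ?thesis
    by (simp add: payoff_def mix_pair_def algebra_simps)
qed

text \<open>The most that the quadratic term can cost any strategy.\<close>

definition penalty :: real where
  "penalty = \<eta> * (K\<^sup>2 * measure \<nu> (space \<nu>))"

text \<open>The strategy from \<open>value_le\<close> depends on \<open>s\<close>; the reply does at
  least as well against \<open>s\<close> once that strategy is charged its penalty.\<close>

lemma payoff_reply_le_value:
  assumes "s \<in> S"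
  shows "payoff s (reply s) \<le> V + penalty"
proof -
  obtain l where l: "l \<in> strategies" "fst s - (\<integral>x. l x * snd s x \<partial>\<nu>) \<le> V"
    using value_le[OF assms] by (auto simp: strategies_def)
  have "(\<integral>x. (l x)\<^sup>2 \<partial>\<nu>) \<le> (\<integral>x. K\<^sup>2 \<partial>\<nu>)"
    using strategies_bound[OF l(1)]
    by (intro integral_mono[OF integrable_power2_strategy[OF l(1)]]) (auto simp: power2_le_iff_abs_le K_nonneg)
  then have "\<eta> * (\<integral>x. (l x)\<^sup>2 \<partial>\<nu>) \<le> penalty"
    using eta_pos by (simp add: penalty_def mult.commute)
  moreover have "0 \<le> \<eta> * (\<integral>x. (l x - reply s x)\<^sup>2 \<partial>\<nu>)"
    using eta_pos by simp
  ultimately show ?thesis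
    using payoff_reply_le[OF assms l(1)] l(2) unfolding payoff_def by linarith
qed

lemma bdd_above_payoff_reply: "bdd_above ((\<lambda>s. payoff s (reply s)) ` S)"
  by (auto intro!: bdd_aboveI2 payoff_reply_le_value)

lemma payoff_reply_le_game_value: "s \<in> S \<Longrightarrow> payoff s (reply s) \<le> game_value"
  unfolding game_value_def
  by (rule cSUP_upper[OF _ bdd_above_payoff_reply])

lemma game_value_le: "game_value \<le> V + penalty"
  unfolding game_value_def by (intro cSUP_least S_nonempty payoff_reply_le_value)

text \<open>
  The reply \<open>m\<close> to a mixture of \<open>s\<close> and \<open>s'\<close> holds the payoff at the mixture below the game value;
  as the payoff is affine along the mixture, this controls both the distance from \<open>m\<close> to the reply
  to \<open>s\<close> and the payoff of \<open>m\<close> against \<open>s'\<close>.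
\<close>

lemma mixture_inequality:
  assumes "s \<in> S" "s' \<in> S" "0 \<le> t" "t \<le> 1"
  defines "m \<equiv> reply (mix_pair t s s')"
  shows "(1 - t) * (payoff s (reply s) + \<eta> * (\<integral>x. (m x - reply s x)\<^sup>2 \<partial>\<nu>)) + t * payoff s' m
      \<le> game_value"
proof -
  have mem: "mix_pair t s s' \<in> S" using mix_closed assms by blast
  then have m: "m \<in> strategies" unfolding m_def by (rule reply_strategies)
  have "(1 - t) * (payoff s (reply s) + \<eta> * (\<integral>x. (m x - reply s x)\<^sup>2 \<partial>\<nu>)) + t * payoff s' m
      \<le> (1 - t) * payoff s m + t * payoff s' m"
    using payoff_reply_le[OF assms(1) m] assms(4) by (intro add_right_mono mult_left_mono) auto
  also have "\<dots> = payoff (mix_pair t s s') m"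
    using payoff_mix_pair[OF assms(1,2) m] by simp
  also have "\<dots> \<le> game_value"
    using payoff_reply_le_game_value[OF mem] by (simp add: m_def)
  finally show ?thesis .
qed

text \<open>Strong convexity at the midpoint: the reply \<open>m\<close> to the half-half mixture
  has average payoff at most \<open>game_value\<close>, while against each pair it pays at least
  \<open>game_value - \<delta>\<close> plus \<open>\<eta>\<close> times its squared distance from
  that pair's reply.\<close>

lemma reply_dist_le:
  assumes "s \<in> S" "s' \<in> S"
    and "payoff s (reply s) \<ge> game_value - \<delta>" "payoff s' (reply s') \<ge> game_value - \<delta>"
  shows "(\<integral>x. (reply s' x - reply s x)\<^sup>2 \<partial>\<nu>) \<le> 4 * \<delta> / \<eta>"
proof -
  define m where "m = reply (mix_pair (1 / 2) s s')"
  have m: "m \<in> strategies"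
    unfolding m_def using mix_closed[of s s' "1/2"] assms by (intro reply_strategies) auto
  have r: "reply s \<in> strategies" "reply s' \<in> strategies" using assms reply_strategies by auto
  note [simp] = integrable_power2_diff_strategy[OF m r(1)] integrable_power2_diff_strategy[OF m r(2)]
    integrable_power2_diff_strategy[OF r(2) r(1)]
  have "(\<integral>x. (reply s' x - reply s x)\<^sup>2 \<partial>\<nu>)
      \<le> (\<integral>x. 2 * (m x - reply s x)\<^sup>2 + 2 * (m x - reply s' x)\<^sup>2 \<partial>\<nu>)"
  proof (rule integral_mono)
    fix x
    \<comment> \<open>Parallelogram law for \<open>m - reply s\<close> and
      \<open>m - reply s'\<close>.\<close>
    have "2 * (m x - reply s x)\<^sup>2 + 2 * (m x - reply s' x)\<^sup>2 - (reply s' x - reply s x)\<^sup>2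
        = (2 * m x - reply s x - reply s' x)\<^sup>2"
      by (simp add: power2_eq_square algebra_simps)
    then show "(reply s' x - reply s x)\<^sup>2
        \<le> 2 * (m x - reply s x)\<^sup>2 + 2 * (m x - reply s' x)\<^sup>2"
      by (smt (verit) zero_le_power2)
  qed simp_all
  also have "\<dots> = 2 * (\<integral>x. (m x - reply s x)\<^sup>2 \<partial>\<nu>) + 2 * (\<integral>x. (m x - reply s' x)\<^sup>2 \<partial>\<nu>)"
    by simp
  finally have "\<eta> * (\<integral>x. (reply s' x - reply s x)\<^sup>2 \<partial>\<nu>)
      \<le> \<eta> * (2 * (\<integral>x. (m x - reply s x)\<^sup>2 \<partial>\<nu>) + 2 * (\<integral>x. (m x - reply s' x)\<^sup>2 \<partial>\<nu>))"
    using eta_pos by (intro mult_left_mono) auto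
  then have 1: "\<eta> * (\<integral>x. (reply s' x - reply s x)\<^sup>2 \<partial>\<nu>)
      \<le> 2 * (\<eta> * (\<integral>x. (m x - reply s x)\<^sup>2 \<partial>\<nu>)) + 2 * (\<eta> * (\<integral>x. (m x - reply s' x)\<^sup>2 \<partial>\<nu>))"
    by (simp only: distrib_left mult.left_commute[of 2 \<eta>])
  have "1 / 2 * (payoff s (reply s) + \<eta> * (\<integral>x. (m x - reply s x)\<^sup>2 \<partial>\<nu>)) + 1 / 2 * payoff s' m
      \<le> game_value"
    using mixture_inequality[OF assms(1,2), of "1 / 2"] by (simp add: m_def)
  then have "payoff s (reply s) + \<eta> * (\<integral>x. (m x - reply s x)\<^sup>2 \<partial>\<nu>) + payoff s' m \<le> 2 * game_value"
    by (simp add: field_simps)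
  with payoff_reply_le[OF assms(2) m] assms(3,4)
  have "\<eta> * (\<integral>x. (m x - reply s x)\<^sup>2 \<partial>\<nu>) + \<eta> * (\<integral>x. (m x - reply s' x)\<^sup>2 \<partial>\<nu>) \<le> 2 * \<delta>"
    by linarith
  with 1 have "\<eta> * (\<integral>x. (reply s' x - reply s x)\<^sup>2 \<partial>\<nu>) \<le> 4 * \<delta>" by linarith
  then show ?thesis using eta_pos by (simp add: field_simps)
qed

text \<open>The reply attains the minimum. The bound limits what a reply to a mixture can gain
  against \<open>s\<close>, which forces it close to the replies along the maximising
  sequence.\<close>

lemma payoff_lower_bound:
  assumes "s \<in> S"
  obtains B where "B \<ge> 0" "\<And>l. l \<in> strategies \<Longrightarrow> payoff s l \<ge> - B"
proof
  define B where "B = \<bar>payoff s (reply s)\<bar>"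
  show "B \<ge> 0" by (simp add: B_def)
  fix l assume "l \<in> strategies"
  from payoff_reply_le[OF assms this] eta_pos have "payoff s (reply s) \<le> payoff s l"
    by (smt (verit) Bochner_Integration.integral_nonneg mult_nonneg_nonneg zero_le_power2)
  then show "payoff s l \<ge> - B" by (simp add: B_def)
qed

section \<open>The limit along a maximising sequence\<close>

text \<open>The rate \<open>1 / 16\<close> is the square of the rate \<open>1 / 4\<close> of the
  mixing weights in \<open>optimal_strategy\<close>, so the defect stays negligible after division
  by the weight.\<close>

lemma maximising_sequence:
  obtains \<sigma> where "\<And>j. \<sigma> j \<in> S"
    "\<And>j. payoff (\<sigma> j) (reply (\<sigma> j)) \<ge> game_value - (1 / 16) ^ j"
proof -
  have "\<exists>s\<in>S. payoff s (reply s) \<ge> game_value - (1 / 16) ^ j" for j :: nat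
  proof -
    have "game_value - (1 / 16) ^ j < (SUP s\<in>S. payoff s (reply s))"
      by (simp add: game_value_def)
    then show ?thesis
      by (auto simp: less_cSUP_iff[OF S_nonempty bdd_above_payoff_reply] intro: less_imp_le)
  qed
  then show thesis using that by metis
qed

text \<open>An arbitrary \<open>s\<close> is mixed with small weight \<open>t j\<close> into a
  maximising sequence. The replies \<open>m j\<close> to the mixtures have the same almost
  everywhere limit as the replies \<open>k j\<close> to the sequence, so the limit does not depend
  on \<open>s\<close>; \<open>mixture_inequality\<close> divided by \<open>t j\<close> bounds the
  payoff of \<open>m j\<close> against \<open>s\<close>.\<close>

lemma optimal_strategy:
  "\<exists>l \<in> borel_measurable \<nu>. (\<forall>x. \<bar>l x\<bar> \<le> K) \<and>
     (\<forall>s\<in>S. fst s - (\<integral>x. l x * snd s x \<partial>\<nu>) \<le> V + penalty)"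
proof -
  obtain \<sigma> where \<sigma>: "\<And>j. \<sigma> j \<in> S"
      "\<And>j. payoff (\<sigma> j) (reply (\<sigma> j)) \<ge> game_value - (1 / 16) ^ j"
    by (rule maximising_sequence) blast
  define k where "k j = reply (\<sigma> j)" for j
  have k: "k j \<in> strategies" for j unfolding k_def by (intro reply_strategies \<sigma>)
  have [measurable]: "k j \<in> borel_measurable \<nu>" for j using k by measurable
  have "AE x in \<nu>. summable (\<lambda>j. \<bar>k (Suc j) x - k j x\<bar>)"
  proof (rule AE_summable_of_integral_power2_le)
    fix j
    show "integrable \<nu> (\<lambda>x. (k (Suc j) x - k j x)\<^sup>2)" by (intro integrable_power2_diff_strategy k)
    have le: "(1 / 16 :: real) ^ Suc j \<le> (1 / 16) ^ j" by (rule power_decreasing) auto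
    have "(\<integral>x. (k (Suc j) x - k j x)\<^sup>2 \<partial>\<nu>) \<le> 4 * (1 / 16) ^ j / \<eta>"
      unfolding k_def using \<sigma>(2)[of j] \<sigma>(2)[of "Suc j"] le
      by (intro reply_dist_le \<sigma>(1)) linarith+
    also have "\<dots> \<le> 4 / \<eta> * (1 / 4) ^ j"
      using eta_pos power_mono[of "1/16::real" "1/4" j] by (simp add: field_simps)
    finally show "(\<integral>x. (k (Suc j) x - k j x)\<^sup>2 \<partial>\<nu>) \<le> 4 / \<eta> * (1 / 4) ^ j" .
  qed measurable
  then have conv: "AE x in \<nu>. (\<lambda>j. k j x) \<longlonglongrightarrow> lim (\<lambda>j. k j x)"
  proof eventually_elim
    case (elim x)
    then have "summable (\<lambda>j. k (Suc j) x - k j x)" by (rule summable_rabs_cancel)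
    then have "convergent (\<lambda>j. k j x)"
      using convergent_diff_const_right_iff[of "\<lambda>j. k j x" "k 0 x"]
      by (simp add: summable_iff_convergent sum_lessThan_telescope[of "\<lambda>j. k j x"])
    then show ?case by (simp add: convergent_LIMSEQ_iff)
  qed
  \<comment> \<open>\<open>lim\<close> is arbitrary where the sequence diverges; clamping enforces
    the bound at every point and changes nothing where it converges.\<close>
  define l where "l x = max (- K) (min K (lim (\<lambda>j. k j x)))" for x
  have l_bound: "\<bar>l x\<bar> \<le> K" for x using K_nonneg by (auto simp: l_def abs_le_iff)
  have l_meas [measurable]: "l \<in> borel_measurable \<nu>" unfolding l_def[abs_def] by measurable
  have "fst s - (\<integral>x. l x * snd s x \<partial>\<nu>) \<le> game_value" if s: "s \<in> S" for s
  proof -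
    obtain B where B: "B \<ge> 0" "\<And>l. l \<in> strategies \<Longrightarrow> payoff s l \<ge> - B"
      using payoff_lower_bound[OF s] by blast
    \<comment> \<open>\<open>Suc j\<close> keeps \<open>t j \<le> 1 / 4\<close>, hence
      \<open>1 - t j\<close> at least \<open>3 / 4\<close>; the defect of the sequence is then
      \<open>16 * (t j)\<^sup>2\<close>.\<close>
    define t :: "nat \<Rightarrow> real" where "t j = (1 / 4) ^ Suc j" for j
    have t: "0 < t j" "t j \<le> 1 / 4" for j
      unfolding t_def using power_le_one[of "1/4::real" j] by simp_all
    define m where "m j = reply (mix_pair (t j) (\<sigma> j) s)" for j
    have m: "m j \<in> strategies" for j
      unfolding m_def using t[of j] by (intro reply_strategies mix_closed \<sigma> s) auto
    have [measurable]: "m j \<in> borel_measurable \<nu>" for j using m by measurable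
    have [measurable]: "snd s \<in> borel_measurable \<nu>" by (rule borel_S[OF s])
    have main: "(1 - t j) * (game_value - (1 / 16) ^ j)
        + (1 - t j) * (\<eta> * (\<integral>x. (m j x - k j x)\<^sup>2 \<partial>\<nu>)) + t j * payoff s (m j) \<le> game_value" for j
    proof -
      have "(1 - t j) * (game_value - (1 / 16) ^ j) \<le> (1 - t j) * payoff (\<sigma> j) (reply (\<sigma> j))"
        using \<sigma>(2)[of j] t(2)[of j] by (intro mult_left_mono) auto
      moreover have "(1 - t j) * payoff (\<sigma> j) (reply (\<sigma> j))
          + (1 - t j) * (\<eta> * (\<integral>x. (m j x - k j x)\<^sup>2 \<partial>\<nu>)) + t j * payoff s (m j) \<le> game_value"
        using mixture_inequality[OF \<sigma>(1)[of j] s, of "t j"] t[of j]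
        by (simp add: m_def k_def distrib_left)
      ultimately show ?thesis by linarith
    qed
    have sq: "(1 / 16 :: real) ^ j = 16 * (t j)\<^sup>2" for j
      by (simp add: t_def power2_eq_square power_divide flip: power_mult_distrib)
    \<comment> \<open>The distance term is dropped, \<open>(1 - t j) * game_value\<close> cancels,
      and the rest is divided by \<open>t j\<close>.\<close>
    have upper: "payoff s (m j) \<le> game_value + 16 * t j" for j
    proof -
      have "0 \<le> (1 - t j) * (\<eta> * (\<integral>x. (m j x - k j x)\<^sup>2 \<partial>\<nu>))"
        using t[of j] eta_pos by simp
      with main[of j] have "t j * payoff s (m j) \<le> t j * game_value + (1 - t j) * (1 / 16) ^ j"
        by (simp add: algebra_simps)
      also have "(1 - t j) * (1 / 16) ^ j \<le> 1 * (1 / 16) ^ j"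
        using t[of j] by (intro mult_right_mono) auto
      finally have "t j * payoff s (m j) \<le> t j * (game_value + 16 * t j)"
        unfolding sq by (simp add: algebra_simps power2_eq_square)
      then show ?thesis using t(1)[of j] by simp
    qed
    \<comment> \<open>The same inequality read for the distance: with the payoff of
      \<open>m j\<close> bounded below by \<open>- B\<close>, only terms of order \<open>t j\<close>
      remain.\<close>
    have "AE x in \<nu>. summable (\<lambda>j. \<bar>m j x - k j x\<bar>)"
    proof (rule AE_summable_of_integral_power2_le)
      fix j
      show "integrable \<nu> (\<lambda>x. (m j x - k j x)\<^sup>2)" by (intro integrable_power2_diff_strategy m k)
      define I where "I = \<eta> * (\<integral>x. (m j x - k j x)\<^sup>2 \<partial>\<nu>)"
      have I: "I \<ge> 0" using eta_pos by (simp add: I_def)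
      have "t j * (- B) \<le> t j * payoff s (m j)"
        using B(2)[OF m] t[of j] by (intro mult_left_mono) auto
      moreover have "(1 - t j) * (1 / 16) ^ j \<le> 1 * (1 / 16) ^ j"
        using t[of j] by (intro mult_right_mono) auto
      moreover have "3 / 4 * I \<le> (1 - t j) * I"
        using t[of j] I by (intro mult_right_mono) auto
      moreover have "t j * game_value \<le> t j * \<bar>game_value\<bar>"
        using t[of j] by (intro mult_left_mono) auto
      moreover have "16 * (t j)\<^sup>2 \<le> 4 * t j"
        using t[of j] mult_right_mono[of "t j" "1/4" "t j"] by (simp add: power2_eq_square)
      ultimately have "3 / 4 * I \<le> t j * (\<bar>game_value\<bar> + B + 4)"
        using main[of j] unfolding I_def[symmetric] sq by (simp add: algebra_simps)
      moreover have "0 \<le> t j * (\<bar>game_value\<bar> + B + 4)" using t(1)[of j] B(1) by simp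
      ultimately have "I \<le> 4 * t j * (\<bar>game_value\<bar> + B + 4)" by linarith
      also have "\<dots> = (1 / 4) ^ j * (\<bar>game_value\<bar> + B + 4)" by (simp add: t_def)
      finally show "(\<integral>x. (m j x - k j x)\<^sup>2 \<partial>\<nu>) \<le> (\<bar>game_value\<bar> + B + 4) / \<eta> * (1 / 4) ^ j"
        using eta_pos by (simp add: I_def field_simps)
    qed measurable
    with conv have lim: "AE x in \<nu>. (\<lambda>j. m j x * snd s x) \<longlonglongrightarrow> l x * snd s x"
    proof eventually_elim
      case (elim x)
      from elim(2) have "(\<lambda>j. m j x - k j x) \<longlonglongrightarrow> 0"
        by (rule tendsto_rabs_zero_cancel[OF summable_LIMSEQ_zero])
      from tendsto_add[OF this elim(1)] have L: "(\<lambda>j. m j x) \<longlonglongrightarrow> lim (\<lambda>j. k j x)" by simp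
      have "- K \<le> lim (\<lambda>j. k j x)" "lim (\<lambda>j. k j x) \<le> K"
        using strategies_bound[OF k] elim(1)
        by (auto intro!: LIMSEQ_le_const[OF elim(1)] LIMSEQ_le_const2[OF elim(1)] simp: abs_le_iff
            minus_le_iff)
      then have "l x = lim (\<lambda>j. k j x)" by (simp add: l_def)
      with L show ?case by (intro tendsto_intros) auto
    qed
    have "(\<lambda>j. \<integral>x. m j x * snd s x \<partial>\<nu>) \<longlonglongrightarrow> (\<integral>x. l x * snd s x \<partial>\<nu>)"
    proof (rule integral_dominated_convergence[where w = "\<lambda>x. K * \<bar>snd s x\<bar>"])
      show "integrable \<nu> (\<lambda>x. K * \<bar>snd s x\<bar>)" using integ[OF s] by simp
      show "AE x in \<nu>. norm (m j x * snd s x) \<le> K * \<bar>snd s x\<bar>" for j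
        using strategies_bound[OF m] by (auto simp: abs_mult intro!: mult_right_mono)
    qed (use lim in auto)
    then have "(\<lambda>j. fst s - (\<integral>x. m j x * snd s x \<partial>\<nu>)) \<longlonglongrightarrow> fst s - (\<integral>x. l x * snd s x \<partial>\<nu>)"
      by (intro tendsto_intros)
    moreover have "(\<lambda>j. game_value + 16 * t j) \<longlonglongrightarrow> game_value + 16 * 0"
      unfolding t_def by (intro tendsto_intros LIMSEQ_Suc LIMSEQ_power_zero) auto
    moreover have "fst s - (\<integral>x. m j x * snd s x \<partial>\<nu>) \<le> game_value + 16 * t j" for j
    proof -
      \<comment> \<open>The penalty is nonnegative and can be discarded from an upper bound, so only
        the linear term passes to the limit.\<close>
      have "0 \<le> \<eta> * (\<integral>x. (m j x)\<^sup>2 \<partial>\<nu>)" using eta_pos by simp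
      with upper[of j] show ?thesis unfolding payoff_def by linarith
    qed
    ultimately show ?thesis by (simp add: LIMSEQ_le)
  qed
  from order_trans[OF this game_value_le]
  have "\<forall>s\<in>S. fst s - (\<integral>x. l x * snd s x \<partial>\<nu>) \<le> V + penalty" by (rule ballI)
  with l_bound show ?thesis by (intro bexI[OF _ l_meas] conjI allI)
qed

end

section \<open>Functionals with small bias\<close>

lemma mix_measure_density:
  fixes p q :: "'a \<Rightarrow> real"
  assumes [measurable]: "p \<in> borel_measurable M" "q \<in> borel_measurable M"
    and nonneg: "\<And>x. 0 \<le> p x" "\<And>x. 0 \<le> q x" and c: "0 \<le> c" "c \<le> 1"
  shows "mix_measure c (density M (\<lambda>x. ennreal (p x))) (density M (\<lambda>x. ennreal (q x)))
    = density M (\<lambda>x. ennreal (c * p x + (1 - c) * q x))"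
proof (rule measure_eqI)
  fix A assume "A \<in> sets (mix_measure c (density M (\<lambda>x. ennreal (p x))) (density M (\<lambda>x. ennreal (q x))))"
  then have A [measurable]: "A \<in> sets M" by simp
  have "(\<integral>\<^sup>+x. ennreal (c * p x + (1 - c) * q x) * indicator A x \<partial>M)
      = (\<integral>\<^sup>+x. ennreal c * (ennreal (p x) * indicator A x)
          + ennreal (1 - c) * (ennreal (q x) * indicator A x) \<partial>M)"
    using nonneg c by (intro nn_integral_cong) (auto simp: ennreal_mult indicator_def)
  also have "\<dots> = ennreal c * (\<integral>\<^sup>+x. ennreal (p x) * indicator A x \<partial>M)
      + ennreal (1 - c) * (\<integral>\<^sup>+x. ennreal (q x) * indicator A x \<partial>M)"
    by (simp add: nn_integral_add nn_integral_cmult)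
  finally show "emeasure (mix_measure c (density M (\<lambda>x. ennreal (p x))) (density M (\<lambda>x. ennreal (q x)))) A
      = emeasure (density M (\<lambda>x. ennreal (c * p x + (1 - c) * q x))) A"
    by (simp add: emeasure_mix_measure emeasure_density)
qed simp

lemma measure_mix_measure:
  assumes "prob_space P0" "prob_space P1" "sets P1 = sets P0" "A \<in> sets P0" "0 \<le> c" "c \<le> 1"
  shows "measure (mix_measure c P0 P1) A = c * measure P0 A + (1 - c) * measure P1 A"
proof -
  interpret P0: prob_space P0 by fact
  interpret P1: prob_space P1 by fact
  have eq: "emeasure (mix_measure c P0 P1) A = ennreal (c * measure P0 A + (1 - c) * measure P1 A)"
    using assms by (simp add: emeasure_mix_measure P0.emeasure_eq_measure P1.emeasure_eq_measure
        ennreal_mult)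
  show ?thesis
    unfolding measure_def[of "mix_measure c P0 P1"] eq by (rule enn2real_ennreal) (use assms in simp)
qed

text \<open>Reweighting by a strictly positive integrable function makes the measure finite without
  creating null sets. Finiteness makes bounded strategies square integrable.\<close>

lemma dominated_on_finite:
  assumes "dominated_on M \<P>"
  obtains \<nu> where "finite_measure \<nu>" "sets \<nu> = sets M" "\<And>P. P \<in> \<P> \<Longrightarrow> absolutely_continuous \<nu> P"
proof -
  obtain \<mu> where "sigma_finite_measure \<mu>" and sets: "sets \<mu> = sets M"
      and ac: "\<And>P. P \<in> \<P> \<Longrightarrow> absolutely_continuous \<mu> P"
    using assms unfolding dominated_on_def by blast
  interpret sigma_finite_measure \<mu> by fact
  obtain f :: "'a \<Rightarrow> real" where f [measurable]: "f \<in> borel_measurable \<mu>"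
      and pos: "\<And>x. f x > 0" and int: "integrable \<mu> f"
    by (rule obtain_positive_integrable_function) blast
  define \<nu> where "\<nu> = density \<mu> (\<lambda>x. ennreal (f x))"
  show thesis
  proof
    have "emeasure \<nu> (space \<nu>) = (\<integral>\<^sup>+x. ennreal (f x) \<partial>\<mu>)"
      by (auto simp: \<nu>_def emeasure_density intro!: nn_integral_cong)
    also have "\<dots> = ennreal (\<integral>x. f x \<partial>\<mu>)"
      using int pos by (intro nn_integral_eq_integral) (auto intro: less_imp_le)
    finally show "finite_measure \<nu>" by (intro finite_measureI) simp
    show "sets \<nu> = sets M" by (simp add: \<nu>_def sets)
    fix P assume "P \<in> \<P>"
    have "null_sets \<nu> \<subseteq> null_sets \<mu>"
    proof
      fix A assume "A \<in> null_sets \<nu>"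
      then have "A \<in> sets \<mu>" "AE x in \<mu>. x \<in> A \<longrightarrow> ennreal (f x) = 0"
        unfolding \<nu>_def by (auto simp: null_sets_density_iff)
      moreover have "ennreal (f x) \<noteq> 0" for x using pos[of x] by simp
      ultimately show "A \<in> null_sets \<mu>" by (simp add: AE_iff_null_sets)
    qed
    then show "absolutely_continuous \<nu> P"
      using ac[OF \<open>P \<in> \<P>\<close>] by (auto simp: absolutely_continuous_def)
  qed
qed

text \<open>Finiteness of \<open>P\<close> permits a real-valued Radon-Nikodym derivative; it is
  nonnegative everywhere, as \<open>mix_measure_density\<close> requires.\<close>

lemma (in finite_measure) obtain_real_density:
  assumes "prob_space P" "absolutely_continuous M P" "sets P = sets M"
  obtains p :: "'a \<Rightarrow> real" where "p \<in> borel_measurable M" "\<And>x. 0 \<le> p x" "integrable M p"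
    "P = density M (\<lambda>x. ennreal (p x))"
proof -
  interpret P: prob_space P by fact
  obtain p where p [measurable]: "p \<in> borel_measurable M"
      and AE: "AE x in M. RN_deriv M P x = ennreal (p x)" and nonneg: "\<And>x. 0 \<le> p x"
    by (rule real_RN_deriv[OF P.finite_measure_axioms assms(2,3)]) (rule that)
  have "density M (RN_deriv M P) = density M (\<lambda>x. ennreal (p x))"
    by (rule density_cong[OF _ _ AE]) measurable
  then have P: "P = density M (\<lambda>x. ennreal (p x))"
    by (simp only: density_RN_deriv[OF assms(2,3)])
  have "(\<integral>\<^sup>+x. ennreal (p x) \<partial>M) = emeasure P (space M)"
    by (subst P) (auto simp: emeasure_density intro!: nn_integral_cong)
  also have "\<dots> = 1" using P.emeasure_space_1 sets_eq_imp_space_eq[OF assms(3)] by simp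
  finally have "integrable M p"
    using nonneg by (intro integrableI_nonneg) auto
  from that[OF p nonneg this P] show thesis .
qed

section \<open>Total variation and the growth of the modulus\<close>

lemma bdd_above_d_TV:
  assumes "prob_space P0" "prob_space P1"
  shows "bdd_above ((\<lambda>A. \<bar>measure P0 A - measure P1 A\<bar>) ` sets P0)"
proof -
  interpret P0: prob_space P0 by fact
  interpret P1: prob_space P1 by fact
  have "\<bar>measure P0 A - measure P1 A\<bar> \<le> 1" for A
    using P0.prob_le_1[of A] P1.prob_le_1[of A] measure_nonneg[of P0 A] measure_nonneg[of P1 A]
    by linarith
  then show ?thesis by (intro bdd_aboveI2[of _ _ 1])
qed

text \<open>On every event the mixture differs from \<open>P1\<close> by \<open>c\<close> times the
  difference of \<open>P0\<close> and \<open>P1\<close>.\<close>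

lemma d_TV_mix_measure_le:
  assumes "prob_space P0" "prob_space P1" "sets P1 = sets P0" "0 \<le> c" "c \<le> 1"
  shows "d_TV (mix_measure c P0 P1) P1 \<le> c * d_TV P0 P1"
  unfolding d_TV_def
proof (rule cSUP_least)
  fix A assume "A \<in> sets (mix_measure c P0 P1)"
  then have A: "A \<in> sets P0" by simp
  have "measure (mix_measure c P0 P1) A - measure P1 A = c * (measure P0 A - measure P1 A)"
    using measure_mix_measure[OF assms(1-3) A assms(4,5)] by (simp add: algebra_simps)
  then have "\<bar>measure (mix_measure c P0 P1) A - measure P1 A\<bar> = c * \<bar>measure P0 A - measure P1 A\<bar>"
    using assms(4) by (simp add: abs_mult)
  also have "\<dots> \<le> c * (SUP A\<in>sets P0. \<bar>measure P0 A - measure P1 A\<bar>)"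
    using bdd_above_d_TV[OF assms(1,2)] A assms(4) by (intro mult_left_mono cSUP_upper)
  finally show "\<bar>measure (mix_measure c P0 P1) A - measure P1 A\<bar>
      \<le> c * (SUP A\<in>sets P0. \<bar>measure P0 A - measure P1 A\<bar>)" .
qed auto

locale bounded_linear_functional =
  fixes M :: "'a measure" and \<P> :: "'a measure set" and \<theta> :: "'a measure \<Rightarrow> real"
  assumes nonempty: "\<P> \<noteq> {}" and prob_algebra: "\<P> \<subseteq> space (prob_algebra M)"
    and convex: "convex_measures \<P>" and linear: "linear_functional_on \<P> \<theta>"
    and bounded: "bounded (\<theta> ` \<P>)"
begin

lemma prob: "P \<in> \<P> \<Longrightarrow> prob_space P" and sets_eq: "P \<in> \<P> \<Longrightarrow> sets P = sets M"
  using prob_algebra by (auto simp: space_prob_algebra)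

text \<open>Boundedness of \<open>\<theta>\<close> makes the real-valued \<open>Sup\<close> a
  genuine upper bound.\<close>

lemma abs_diff_le_omega_TV:
  assumes "P \<in> \<P>" "Q \<in> \<P>" "d_TV P Q \<le> \<epsilon>"
  shows "\<bar>\<theta> P - \<theta> Q\<bar> \<le> omega_TV \<P> \<theta> \<epsilon>"
proof -
  obtain B where B: "\<And>P. P \<in> \<P> \<Longrightarrow> \<bar>\<theta> P\<bar> \<le> B" using bounded by (auto simp: bounded_iff)
  have "bdd_above {\<bar>\<theta> P0 - \<theta> P1\<bar> | P0 P1. P0 \<in> \<P> \<and> P1 \<in> \<P> \<and> d_TV P0 P1 \<le> \<epsilon>}"
  proof (rule bdd_aboveI)
    fix r assume "r \<in> {\<bar>\<theta> P0 - \<theta> P1\<bar> | P0 P1. P0 \<in> \<P> \<and> P1 \<in> \<P> \<and> d_TV P0 P1 \<le> \<epsilon>}"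
    then obtain P0 P1 where "r = \<bar>\<theta> P0 - \<theta> P1\<bar>" "P0 \<in> \<P>" "P1 \<in> \<P>" by blast
    then show "r \<le> 2 * B" using B[of P0] B[of P1] by linarith
  qed
  then show ?thesis unfolding omega_TV_def by (rule cSup_upper[rotated]) (use assms in blast)
qed

lemma omega_TV_nonneg:
  assumes "\<epsilon> \<ge> 0"
  shows "omega_TV \<P> \<theta> \<epsilon> \<ge> 0"
proof -
  obtain P where P: "P \<in> \<P>" using nonempty by blast
  have "sets P \<noteq> {}" using sets.empty_sets by blast
  then have "d_TV P P = 0" by (simp add: d_TV_def)
  with abs_diff_le_omega_TV[OF P P, of \<epsilon>] assms show ?thesis by simp
qed

text \<open>Shrinking a pair towards one of its members scales both distances, so the modulus grows at
  most linearly beyond \<open>\<epsilon>\<close>.\<close>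

lemma abs_diff_le_scaled_omega_TV:
  assumes "P \<in> \<P>" "Q \<in> \<P>" "0 < \<epsilon>" "\<epsilon> \<le> d_TV P Q"
  shows "\<bar>\<theta> P - \<theta> Q\<bar> \<le> d_TV P Q / \<epsilon> * omega_TV \<P> \<theta> \<epsilon>"
proof -
  define t where "t = \<epsilon> / d_TV P Q"
  have d: "d_TV P Q > 0" using assms by linarith
  then have t: "0 < t" "t \<le> 1" using assms by (auto simp: t_def)
  have R: "mix_measure t P Q \<in> \<P>" using convex assms t by (auto simp: convex_measures_def)
  have "d_TV (mix_measure t P Q) Q \<le> t * d_TV P Q"
    using assms t by (intro d_TV_mix_measure_le prob) (auto simp: sets_eq)
  also have "\<dots> = \<epsilon>" using d by (simp add: t_def)
  finally have "\<bar>\<theta> (mix_measure t P Q) - \<theta> Q\<bar> \<le> omega_TV \<P> \<theta> \<epsilon>"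
    by (rule abs_diff_le_omega_TV[OF R assms(2)])
  moreover have "\<theta> (mix_measure t P Q) - \<theta> Q = t * (\<theta> P - \<theta> Q)"
    using linear assms t by (simp add: linear_functional_on_def algebra_simps)
  ultimately have "t * \<bar>\<theta> P - \<theta> Q\<bar> \<le> omega_TV \<P> \<theta> \<epsilon>"
    using t by (simp add: abs_mult)
  then show ?thesis using d assms(3) by (simp add: t_def field_simps)
qed

text \<open>Convexity makes \<open>closest_point\<close> onto the closure of the range
  nonexpansive.\<close>

lemma convex_range: "convex (\<theta> ` \<P>)"
proof (rule convexI)
  fix x y u v :: real
  assume "x \<in> \<theta> ` \<P>" "y \<in> \<theta> ` \<P>" and uv: "0 \<le> u" "0 \<le> v" "u + v = 1"
  then obtain P Q where PQ: "P \<in> \<P>" "Q \<in> \<P>" "x = \<theta> P" "y = \<theta> Q" by blast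
  have v: "v = 1 - u" using uv by simp
  have "mix_measure u P Q \<in> \<P>" using convex PQ uv by (auto simp: convex_measures_def)
  moreover have "\<theta> (mix_measure u P Q) = u * x + v * y"
    using linear PQ uv by (simp add: linear_functional_on_def v)
  ultimately show "u *\<^sub>R x + v *\<^sub>R y \<in> \<theta> ` \<P>"
    unfolding real_scaleR_def by (metis imageI)
qed

text \<open>\<open>\<theta> P\<close> is a fixed point of the nonexpansive projection.\<close>

lemma abs_projection_le:
  assumes "P \<in> \<P>"
  shows "\<bar>closest_point (closure (\<theta> ` \<P>)) y - \<theta> P\<bar> \<le> \<bar>y - \<theta> P\<bar>"
proof -
  let ?S = "closure (\<theta> ` \<P>)"
  have mem: "\<theta> P \<in> ?S" using closure_subset[of "\<theta> ` \<P>"] assms by auto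
  have "dist (closest_point ?S y) (closest_point ?S (\<theta> P)) \<le> dist y (\<theta> P)"
    by (intro closest_point_lipschitz convex_closure convex_range closed_closure) (use mem in auto)
  then show ?thesis by (simp add: closest_point_self[OF mem] dist_real_def)
qed

text \<open>The test function \<open>K (2 \<cdot> 1\<^sub>A - 1)\<close>, with \<open>A\<close> nearly attaining the total variation distance, separates
  \<open>P\<close> from \<open>Q\<close> once they are further than \<open>\<epsilon>\<close> apart.\<close>

lemma best_reply_value:
  fixes \<epsilon> :: real
  defines "\<omega> \<equiv> omega_TV \<P> \<theta> \<epsilon>"
  defines "K \<equiv> \<omega> / (2 * \<epsilon>)"
  assumes P: "P \<in> \<P>" and Q: "Q \<in> \<P>" and eps: "\<epsilon> > 0"
  shows "\<exists>l \<in> borel_measurable M. (\<forall>x. \<bar>l x\<bar> \<le> K) \<and>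
    \<theta> P - \<theta> Q - ((\<integral>x. l x \<partial>P) - (\<integral>x. l x \<partial>Q)) \<le> \<omega>"
proof (cases "d_TV P Q \<le> \<epsilon>")
  case True
  have "K \<ge> 0" using omega_TV_nonneg[of \<epsilon>] eps by (simp add: K_def \<omega>_def)
  with abs_diff_le_omega_TV[OF P Q True] show ?thesis
    by (intro bexI[of _ "\<lambda>_. 0"]) (auto simp: \<omega>_def)
next
  case False
  interpret P: prob_space P by (rule prob[OF P])
  interpret Q: prob_space Q by (rule prob[OF Q])
  have K: "K \<ge> 0" using omega_TV_nonneg[of \<epsilon>] eps by (simp add: K_def \<omega>_def)
  have ne: "sets P \<noteq> {}" using sets.empty_sets by blast
  \<comment> \<open>The supremum need not be attained; missing it by less than
    \<open>\<epsilon>\<close> costs at most \<open>2 * K * \<epsilon>\<close>, which is exactly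
    \<open>\<omega>\<close>.\<close>
  have "d_TV P Q - \<epsilon> < (SUP A\<in>sets P. \<bar>measure P A - measure Q A\<bar>)"
    using eps by (simp add: d_TV_def)
  then obtain A where "A \<in> sets P" and dA: "d_TV P Q - \<epsilon> < \<bar>measure P A - measure Q A\<bar>"
    unfolding less_cSUP_iff[OF ne bdd_above_d_TV[OF prob[OF P] prob[OF Q]]] by (rule bexE)
  then have A: "A \<in> sets M" by (simp add: sets_eq P)
  \<comment> \<open>The sign turns the difference of the integrals of \<open>l\<close> into
    \<open>2 * K\<close> times the absolute difference on \<open>A\<close>.\<close>
  define \<sigma> :: real where "\<sigma> = (if measure P A \<ge> measure Q A then 1 else - 1)"
  define l where "l x = \<sigma> * K * (2 * indicator A x - 1)" for x
  have int: "(\<integral>x. l x \<partial>R) = \<sigma> * K * (2 * measure R A - 1)" if "R \<in> \<P>" for R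
  proof -
    interpret R: prob_space R by (rule prob[OF that])
    have "integrable R (indicator A :: 'a \<Rightarrow> real)"
      using A by (intro integrable_real_indicator) (simp_all add: sets_eq that less_top[symmetric])
    moreover have "A \<in> sets R" using A by (simp add: sets_eq that)
    ultimately show ?thesis by (simp add: l_def R.prob_space)
  qed
  have "\<theta> P - \<theta> Q \<le> d_TV P Q / \<epsilon> * \<omega>"
    using abs_diff_le_scaled_omega_TV[OF P Q eps] False by (simp add: \<omega>_def)
  also have "\<dots> = 2 * K * d_TV P Q" using eps by (simp add: K_def)
  also have "\<dots> \<le> 2 * K * (\<bar>measure P A - measure Q A\<bar> + \<epsilon>)"
    using K dA by (intro mult_left_mono) auto
  also have "\<dots> = 2 * K * \<bar>measure P A - measure Q A\<bar> + \<omega>"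
    using eps by (simp add: K_def algebra_simps)
  also have "2 * K * \<bar>measure P A - measure Q A\<bar> = (\<integral>x. l x \<partial>P) - (\<integral>x. l x \<partial>Q)"
    unfolding int[OF P] int[OF Q] by (simp add: \<sigma>_def algebra_simps)
  finally have "\<theta> P - \<theta> Q - ((\<integral>x. l x \<partial>P) - (\<integral>x. l x \<partial>Q)) \<le> \<omega>" by simp
  moreover have "\<forall>x. \<bar>l x\<bar> \<le> K" using K by (simp add: l_def \<sigma>_def indicator_def)
  moreover have "l \<in> borel_measurable M" unfolding l_def[abs_def] using A by measurable
  ultimately show ?thesis by (intro bexI[of _ l] conjI)
qed

text \<open>By \<open>best_reply_value\<close> the unpenalised value is at most
  \<open>\<omega>\<close>, and \<open>\<eta>\<close> makes the penalty at most another
  \<open>\<omega>\<close>. So \<open>\<theta> P\<close> minus the integral of the optimal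
  \<open>l\<close> oscillates by at most \<open>2 * \<omega>\<close> over \<open>\<P>\<close>, and
  centring halves this.\<close>

lemma near_unbiased_functional:
  fixes \<epsilon> :: real
  defines "\<omega> \<equiv> omega_TV \<P> \<theta> \<epsilon>"
  defines "K \<equiv> \<omega> / (2 * \<epsilon>)"
  assumes dom: "dominated_on M \<P>" and eps: "\<epsilon> > 0" and pos: "\<omega> > 0"
  shows "\<exists>l \<in> borel_measurable M. (\<forall>x. \<bar>l x\<bar> \<le> K) \<and>
    (\<exists>b. \<forall>P\<in>\<P>. \<bar>(\<integral>x. l x \<partial>P) + b - \<theta> P\<bar> \<le> \<omega>)"
proof -
  have K: "K > 0" using eps pos by (simp add: K_def)
  obtain \<nu> where "finite_measure \<nu>" and sets: "sets \<nu> = sets M"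
      and ac: "\<And>P. P \<in> \<P> \<Longrightarrow> absolutely_continuous \<nu> P"
    by (rule dominated_on_finite[OF dom]) blast
  interpret \<nu>: finite_measure \<nu> by fact
  have "\<exists>p. p \<in> borel_measurable \<nu> \<and> (\<forall>x. 0 \<le> p x) \<and> integrable \<nu> p \<and>
      P = density \<nu> (\<lambda>x. ennreal (p x))" if P: "P \<in> \<P>" for P
  proof -
    have "sets P = sets \<nu>" using sets_eq[OF P] sets by simp
    then obtain p where "p \<in> borel_measurable \<nu>" "\<And>x. 0 \<le> p x" "integrable \<nu> p"
        "P = density \<nu> (\<lambda>x. ennreal (p x))"
      by (rule \<nu>.obtain_real_density[OF prob[OF P] ac[OF P]]) (rule that)
    then show ?thesis by blast
  qed
  then obtain p where p: "\<And>P. P \<in> \<P> \<Longrightarrow> p P \<in> borel_measurable \<nu>"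
      "\<And>P x. P \<in> \<P> \<Longrightarrow> 0 \<le> p P x" "\<And>P. P \<in> \<P> \<Longrightarrow> integrable \<nu> (p P)"
      "\<And>P. P \<in> \<P> \<Longrightarrow> P = density \<nu> (\<lambda>x. ennreal (p P x))"
    by metis
  \<comment> \<open>A relation rather than the chosen density \<open>p P\<close>: a combination of
    densities is a density of the mixture, but need not be the one chosen for it, and
    \<open>mix_closed\<close> asks for equality of functions.\<close>
  define is_density where "is_density P f \<longleftrightarrow> f \<in> borel_measurable \<nu> \<and> (\<forall>x. 0 \<le> f x) \<and>
    integrable \<nu> f \<and> P = density \<nu> (\<lambda>x. ennreal (f x))" for P and f :: "'a \<Rightarrow> real"
  have mix: "is_density (mix_measure c P Q) (\<lambda>x. c * f x + (1 - c) * g x)"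
    if "is_density P f" "is_density Q g" "0 \<le> c" "c \<le> 1" for P Q f g c
  proof -
    have fg: "f \<in> borel_measurable \<nu>" "\<And>x. 0 \<le> f x" "integrable \<nu> f"
        "g \<in> borel_measurable \<nu>" "\<And>x. 0 \<le> g x" "integrable \<nu> g"
      and PQ: "P = density \<nu> (\<lambda>x. ennreal (f x))" "Q = density \<nu> (\<lambda>x. ennreal (g x))"
      using that(1,2) unfolding is_density_def by blast+
    show ?thesis
      unfolding is_density_def PQ mix_measure_density[OF fg(1,4,2,5) that(3,4)]
      using fg that(3,4) by (intro conjI allI) simp_all
  qed
  define S where "S = {(\<theta> P - \<theta> Q, \<lambda>x. f x - g x) | P Q f g.
    P \<in> \<P> \<and> Q \<in> \<P> \<and> is_density P f \<and> is_density Q g}"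
  have memS: "(\<theta> P - \<theta> Q, \<lambda>x. f x - g x) \<in> S"
    if "P \<in> \<P>" "Q \<in> \<P>" "is_density P f" "is_density Q g" for P Q f g
    unfolding S_def using that by blast
  have dens: "is_density P (p P)" if "P \<in> \<P>" for P
    unfolding is_density_def by (intro conjI allI p that)
  have int: "(\<integral>x. l x * (f x - g x) \<partial>\<nu>) = (\<integral>x. l x \<partial>P) - (\<integral>x. l x \<partial>Q)"
    if fg: "is_density P f" "is_density Q g" and l: "l \<in> borel_measurable \<nu>" "\<And>x. \<bar>l x\<bar> \<le> K"
    for l P Q f g
  proof -
    have *: "integrable \<nu> (\<lambda>x. l x * f x) \<and> (\<integral>x. l x \<partial>P) = (\<integral>x. l x * f x \<partial>\<nu>)"
      if "is_density P f" for P f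
    proof
      have [measurable]: "f \<in> borel_measurable \<nu>" and f: "\<And>x. 0 \<le> f x" "integrable \<nu> f"
          "P = density \<nu> (\<lambda>x. ennreal (f x))"
        using that unfolding is_density_def by blast+
      note [measurable] = l(1)
      show "integrable \<nu> (\<lambda>x. l x * f x)"
      proof (rule Bochner_Integration.integrable_bound[of _ "\<lambda>x. K * f x"])
        show "AE x in \<nu>. norm (l x * f x) \<le> norm (K * f x)"
          using l(2) f(1) K by (auto simp: abs_mult intro!: mult_right_mono)
      qed (use f(2) in simp_all)
      show "(\<integral>x. l x \<partial>P) = (\<integral>x. l x * f x \<partial>\<nu>)"
        unfolding f(3) using f(1)
        by (subst integral_real_density) (simp_all add: mult.commute)
    qed
    then show ?thesis using fg by (simp add: right_diff_distrib)
  qed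
  \<comment> \<open>Chosen to give \<open>penalty \<le> \<omega>\<close>; the \<open>+ 1\<close>
    keeps the denominator positive whatever the total mass.\<close>
  define \<eta> where "\<eta> = \<omega> / (K\<^sup>2 * (measure \<nu> (space \<nu>) + 1))"
  have \<nu>_pos: "measure \<nu> (space \<nu>) + 1 > 0" by (simp add: add_nonneg_pos)
  interpret penalised_game \<nu> S K \<omega> \<eta>
  proof
    obtain P where P: "P \<in> \<P>" using nonempty by blast
    show "S \<noteq> {}" using memS[OF P P dens[OF P] dens[OF P]] by blast
    show "K \<ge> 0" using K by simp
    show "\<eta> > 0" unfolding \<eta>_def using K pos \<nu>_pos by (intro divide_pos_pos mult_pos_pos) auto
  next
    fix s assume "s \<in> S"
    then obtain P Q f g where s: "s = (\<theta> P - \<theta> Q, \<lambda>x. f x - g x)"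
        and PQ: "P \<in> \<P>" "Q \<in> \<P>" "is_density P f" "is_density Q g"
      unfolding S_def by blast
    have "integrable \<nu> f" "integrable \<nu> g" using PQ(3,4) unfolding is_density_def by blast+
    then show "integrable \<nu> (snd s)" by (simp add: s)
    obtain l where l: "l \<in> borel_measurable M" and l_le: "(\<forall>x. \<bar>l x\<bar> \<le> K) \<and>
        \<theta> P - \<theta> Q - ((\<integral>x. l x \<partial>P) - (\<integral>x. l x \<partial>Q)) \<le> \<omega>"
      using best_reply_value[OF PQ(1,2) eps] unfolding K_def \<omega>_def by (rule bexE)
    have l': "l \<in> borel_measurable \<nu>" using l by (simp cong: measurable_cong_sets add: sets)
    have "fst s - (\<integral>x. l x * snd s x \<partial>\<nu>) \<le> \<omega>"
      using int[OF PQ(3,4) l' conjunct1[OF l_le, THEN spec]] conjunct2[OF l_le] by (simp add: s)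
    with conjunct1[OF l_le] show "\<exists>l \<in> borel_measurable \<nu>. (\<forall>x. \<bar>l x\<bar> \<le> K) \<and>
          fst s - (\<integral>x. l x * snd s x \<partial>\<nu>) \<le> \<omega>"
      by (intro bexI[OF _ l'] conjI)
  next
    fix s s' and t :: real assume ss: "s \<in> S" "s' \<in> S" and t: "0 \<le> t" "t \<le> 1"
    from ss(1) obtain P Q f g where s: "s = (\<theta> P - \<theta> Q, \<lambda>x. f x - g x)"
        and PQ: "P \<in> \<P>" "Q \<in> \<P>" "is_density P f" "is_density Q g"
      unfolding S_def by blast
    from ss(2) obtain P' Q' f' g' where s': "s' = (\<theta> P' - \<theta> Q', \<lambda>x. f' x - g' x)"
        and PQ': "P' \<in> \<P>" "Q' \<in> \<P>" "is_density P' f'" "is_density Q' g'"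
      unfolding S_def by blast
    \<comment> \<open>Translates the weight on the second pair into the weight on the first
      measure.\<close>
    let ?c = "1 - t"
    have c: "?c \<in> {0..1}" using t by auto
    have R: "mix_measure ?c P P' \<in> \<P>" "mix_measure ?c Q Q' \<in> \<P>"
      using convex PQ PQ' c unfolding convex_measures_def by blast+
    have d: "is_density (mix_measure ?c P P') (\<lambda>x. ?c * f x + (1 - ?c) * f' x)"
        "is_density (mix_measure ?c Q Q') (\<lambda>x. ?c * g x + (1 - ?c) * g' x)"
      by (intro mix PQ PQ'; use t in simp)+
    have "\<theta> (mix_measure ?c P P') = ?c * \<theta> P + (1 - ?c) * \<theta> P'"
        "\<theta> (mix_measure ?c Q Q') = ?c * \<theta> Q + (1 - ?c) * \<theta> Q'"
      using linear PQ PQ' c unfolding linear_functional_on_def by blast+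
    then have "mix_pair t s s' = (\<theta> (mix_measure ?c P P') - \<theta> (mix_measure ?c Q Q'),
        \<lambda>x. (?c * f x + (1 - ?c) * f' x) - (?c * g x + (1 - ?c) * g' x))"
      by (simp add: mix_pair_def s s' algebra_simps)
    with memS[OF R d] show "mix_pair t s s' \<in> S" by simp
  qed
  have "penalty = \<omega> * (measure \<nu> (space \<nu>) / (measure \<nu> (space \<nu>) + 1))"
    using K unfolding penalty_def by (simp add: \<eta>_def)
  also have "\<dots> \<le> \<omega> * 1" using pos \<nu>_pos by (intro mult_left_mono) (auto simp: divide_le_eq)
  finally have penalty: "penalty \<le> \<omega>" by simp
  obtain l where l: "l \<in> borel_measurable \<nu>" and l_opt: "(\<forall>x. \<bar>l x\<bar> \<le> K) \<and>
      (\<forall>s\<in>S. fst s - (\<integral>x. l x * snd s x \<partial>\<nu>) \<le> \<omega> + penalty)"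
    using optimal_strategy by (rule bexE)
  from l_opt have l_bound: "\<bar>l x\<bar> \<le> K" for x by (rule conjunct1[THEN spec])
  from l_opt have opt: "\<forall>s\<in>S. fst s - (\<integral>x. l x * snd s x \<partial>\<nu>) \<le> \<omega> + penalty" by (rule conjunct2)
  define D where "D P = \<theta> P - (\<integral>x. l x \<partial>P)" for P
  have osc: "D P - D Q \<le> 2 * \<omega>" if "P \<in> \<P>" "Q \<in> \<P>" for P Q
  proof -
    note d = dens[OF that(1)] dens[OF that(2)]
    show ?thesis using int[OF d l l_bound] bspec[OF opt memS[OF that d]] penalty by (simp add: D_def)
  qed
  obtain P0 where P0: "P0 \<in> \<P>" using nonempty by blast
  have lower: "D P - 2 * \<omega> \<le> D Q" if "P \<in> \<P>" "Q \<in> \<P>" for P Q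
    using osc[OF that] by linarith
  have bdd: "bdd_below (D ` \<P>)" by (rule bdd_belowI2[OF lower[OF P0]])
  define m where "m = (INF P\<in>\<P>. D P)"
  \<comment> \<open>All values of \<open>D\<close> lie in \<open>[m, m + 2 * \<omega>]\<close>, so
    the shift is the midpoint.\<close>
  have bias: "\<bar>(\<integral>x. l x \<partial>P) + (m + \<omega>) - \<theta> P\<bar> \<le> \<omega>" if P: "P \<in> \<P>" for P
  proof -
    have "m \<le> D P" unfolding m_def by (rule cINF_lower[OF bdd P])
    moreover have "D P - 2 * \<omega> \<le> m"
      unfolding m_def by (rule cINF_greatest[OF nonempty lower[OF P]])
    ultimately show ?thesis unfolding D_def abs_le_iff by linarith
  qed
  have "l \<in> borel_measurable M" using l by (simp cong: measurable_cong_sets add: sets)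
  moreover have "\<exists>b. \<forall>P\<in>\<P>. \<bar>(\<integral>x. l x \<partial>P) + b - \<theta> P\<bar> \<le> \<omega>"
    by (rule exI[of _ "m + \<omega>"]) (rule ballI, rule bias)
  ultimately show ?thesis
    using conjunct1[OF l_opt] by (intro bexI[of _ l] conjI)
qed

end

section \<open>Privatised observations\<close>

lemma AE_Q1_bounded:
  "AE z in Q1 M \<alpha> l x. \<bar>z\<bar> \<le> \<bar>z0 M \<alpha> l\<bar>"
  unfolding Q1_def by (auto simp: AE_return AE_distr_iff)

text \<open>The weights are chosen so that the kernel has mean \<open>l x\<close>. The clamp is the
  identity on its support and supplies the bounded integrand that \<open>integral_bind\<close> asks
  for.\<close>

lemma integral_Q1_clamp:
  assumes "\<alpha> > 0" "l \<in> L_infty M" "x \<in> space M"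
  shows "(\<integral>z. max (- \<bar>z0 M \<alpha> l\<bar>) (min \<bar>z0 M \<alpha> l\<bar> z) \<partial>Q1 M \<alpha> l x) = l x"
proof (cases "sup_norm M l = 0")
  case True
  then have "l x = 0" using abs_le_sup_norm[OF assms(2,3)] by simp
  with True show ?thesis by (simp add: Q1_def integral_return)
next
  case False
  have "exp \<alpha> + 1 \<noteq> 0" using exp_gt_zero[of \<alpha>] by linarith
  with False have z: "z0 M \<alpha> l \<noteq> 0" using assms(1) by (simp add: z0_def)
  have "0 \<le> 1 / 2 * (1 + l x / z0 M \<alpha> l)" "1 / 2 * (1 + l x / z0 M \<alpha> l) \<le> 1"
    using Q1_weight_bounds[OF assms] by auto
  then show ?thesis
    using False z by (simp add: Q1_def integral_distr field_simps)
qed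

lemma
  assumes "\<alpha> > 0" "l \<in> L_infty M" "P \<in> space (prob_algebra M)"
  shows prob_space_bind_Q1: "prob_space (P \<bind> Q1 M \<alpha> l)"
    and sets_bind_Q1: "sets (P \<bind> Q1 M \<alpha> l) = sets borel"
    and AE_bind_Q1: "AE z in P \<bind> Q1 M \<alpha> l. \<bar>z\<bar> \<le> \<bar>z0 M \<alpha> l\<bar>"
    and integral_bind_Q1: "(\<integral>z. z \<partial>(P \<bind> Q1 M \<alpha> l)) = (\<integral>x. l x \<partial>P)"
proof -
  have P: "sets P = sets M" "prob_space P"
    using assms(3) by (auto simp: space_prob_algebra)
  interpret P: prob_space P by (rule P)
  let ?R = "P \<bind> Q1 M \<alpha> l" and ?z = "\<bar>z0 M \<alpha> l\<bar>"
  have Q: "Q1 M \<alpha> l \<in> measurable P (subprob_algebra borel)"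
    using measurable_Q1[OF assms(1,2)] by (simp add: measurable_cong_sets[OF P(1) refl])
  show "prob_space ?R" by (rule P.prob_space_bind[OF _ Q]) (simp add: prob_space_Q1)
  show sets: "sets ?R = sets borel" by (rule sets_bind) (auto simp: P.not_empty)
  show AE: "AE z in ?R. \<bar>z\<bar> \<le> ?z"
    by (subst AE_bind[OF Q]) (auto simp: AE_Q1_bounded)
  \<comment> \<open>The clamp agrees with the identity almost everywhere and allows the integral to
    be split over the kernel.\<close>
  have "(\<integral>z. z \<partial>?R) = (\<integral>z. max (- ?z) (min ?z z) \<partial>?R)"
    using AE by (intro integral_cong_AE) (auto simp: sets cong: measurable_cong_sets)
  also have "\<dots> = (\<integral>x. (\<integral>z. max (- ?z) (min ?z z) \<partial>Q1 M \<alpha> l x) \<partial>P)"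
    by (rule integral_bind[where K = borel and B = ?z and B' = 1, OF _ _ Q])
      (auto simp: abs_le_iff P.finite_measure_axioms prob_space.emeasure_space_1[OF prob_space_Q1]
        simp del: space_Q1)
  also have "\<dots> = (\<integral>x. l x \<partial>P)"
    using integral_Q1_clamp[OF assms(1,2)] sets_eq_imp_space_eq[OF P(1)]
    by (intro Bochner_Integration.integral_cong) auto
  finally show "(\<integral>z. z \<partial>?R) = (\<integral>x. l x \<partial>P)" .
qed

section \<open>Exponential moments of the sample mean\<close>

text \<open>Hoeffding's lemma with parameter \<open>c / n\<close> on an interval of length
  \<open>2 * B\<close>, multiplied over the \<open>n\<close> independent coordinates. The sign
  \<open>s\<close> covers both tails.\<close>

lemma nn_integral_exp_mean_le:
  fixes R :: "real measure"
  assumes "prob_space R" and sets: "sets R = sets borel" and AE: "AE z in R. \<bar>z\<bar> \<le> B"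
    and n: "n \<ge> 1" and c: "c > 0" and s: "\<bar>s\<bar> = 1"
  shows "(\<integral>\<^sup>+Z. ennreal (exp (c * (s * ((\<Sum>i<n. Z i) / real n - (\<integral>z. z \<partial>R))))) \<partial>(\<Pi>\<^sub>M i\<in>{..<n}. R))
    \<le> ennreal (exp (c\<^sup>2 * B\<^sup>2 / (2 * real n)))"
proof -
  interpret R: prob_space R by fact
  interpret interval_bounded_random_variable R "\<lambda>z. s * z" "- B" B
  proof
    show "(\<lambda>z. s * z) \<in> borel_measurable R"
      by (simp add: sets cong: measurable_cong_sets)
    show "AE z in R. s * z \<in> {- B..B}"
      using AE
    proof eventually_elim
      case (elim z)
      then have "\<bar>s * z\<bar> \<le> B" using s by (simp add: abs_mult)
      then show ?case by (simp add: abs_le_iff)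
    qed
  qed
  interpret product_sigma_finite "\<lambda>_::nat. R" by standard
  define m where "m = (\<integral>z. z \<partial>R)"
  have E: "R.expectation (\<lambda>z. s * z) = s * m" by (simp add: m_def)
  have one: "(\<integral>\<^sup>+z. ennreal (exp (c / n * (s * z - s * m))) \<partial>R)
      \<le> ennreal (exp ((c / n)\<^sup>2 * (B - - B)\<^sup>2 / 8))"
    using Hoeffdings_lemma_nn_integral[of "c / n"] c n unfolding E by simp
  have "exp (c * (s * ((\<Sum>i<n. Z i) / n - m))) = (\<Prod>i<n. exp (c / n * (s * Z i - s * m)))" for Z
  proof -
    have "(\<Sum>i<n. c / n * (s * Z i - s * m)) = c / n * (s * (\<Sum>i<n. Z i) - s * (n * m))"
      by (simp only: sum_distrib_left[symmetric] sum_subtractf sum_constant card_lessThan)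
    also have "\<dots> = c * (s * ((\<Sum>i<n. Z i) / n - m))" using n by (simp add: field_simps)
    finally show ?thesis by (simp add: exp_sum[symmetric])
  qed
  then have "(\<integral>\<^sup>+Z. ennreal (exp (c * (s * ((\<Sum>i<n. Z i) / n - m)))) \<partial>(\<Pi>\<^sub>M i\<in>{..<n}. R))
      = (\<integral>\<^sup>+Z. (\<Prod>i<n. ennreal (exp (c / n * (s * Z i - s * m)))) \<partial>(\<Pi>\<^sub>M i\<in>{..<n}. R))"
    by (simp add: prod_ennreal)
  also have "\<dots> = (\<Prod>i<n. \<integral>\<^sup>+z. ennreal (exp (c / n * (s * z - s * m))) \<partial>R)"
    by (rule product_nn_integral_prod) (auto simp: sets cong: measurable_cong_sets)
  also have "\<dots> \<le> (\<Prod>i<n. ennreal (exp ((c / n)\<^sup>2 * (B - - B)\<^sup>2 / 8)))"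
    by (intro prod_mono_ennreal one)
  also have "\<dots> = ennreal (exp (n * ((c / n)\<^sup>2 * (B - - B)\<^sup>2 / 8)))"
    by (simp add: ennreal_power flip: exp_of_nat_mult)
  also have "n * ((c / n)\<^sup>2 * (B - - B)\<^sup>2 / 8) = c\<^sup>2 * B\<^sup>2 / (2 * real n)"
    using n by (simp add: field_simps power2_eq_square)
  finally show ?thesis by (simp add: m_def)
qed

lemma borel_measurable_sample_mean:
  assumes "sets R = sets borel"
  shows "(\<lambda>Z. (\<Sum>i<n. Z i) / real n) \<in> borel_measurable (\<Pi>\<^sub>M i\<in>{..<n}. R)"
proof -
  have "(\<lambda>Z. Z i) \<in> borel_measurable (\<Pi>\<^sub>M i\<in>{..<n}. R)" if "i < n" for i
    using measurable_component_singleton[of i "{..<n}" "\<lambda>_. R"] that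
    by (simp cong: measurable_cong_sets add: assms)
  then show ?thesis by (intro borel_measurable_divide borel_measurable_sum) auto
qed

text \<open>The exponential of an absolute value is at most the sum of the two signed exponentials,
  whence the factor 2.\<close>

lemma nn_integral_exp_abs_mean_le:
  fixes R :: "real measure"
  assumes "prob_space R" and sets: "sets R = sets borel" and "AE z in R. \<bar>z\<bar> \<le> B"
    and "n \<ge> 1" and "c > 0"
  shows "(\<integral>\<^sup>+Z. ennreal (exp (c * \<bar>(\<Sum>i<n. Z i) / real n - (\<integral>z. z \<partial>R)\<bar>)) \<partial>(\<Pi>\<^sub>M i\<in>{..<n}. R))
    \<le> ennreal (2 * exp (c\<^sup>2 * B\<^sup>2 / (2 * real n)))"
proof -
  let ?f = "\<lambda>s Z. exp (c * (s * ((\<Sum>i<n. Z i) / real n - (\<integral>z. z \<partial>R))))"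
  note le = nn_integral_exp_mean_le[OF assms]
  note [measurable] = borel_measurable_sample_mean[OF sets]
  have "(\<integral>\<^sup>+Z. ennreal (exp (c * \<bar>(\<Sum>i<n. Z i) / real n - (\<integral>z. z \<partial>R)\<bar>)) \<partial>(\<Pi>\<^sub>M i\<in>{..<n}. R))
      \<le> (\<integral>\<^sup>+Z. ennreal (?f 1 Z) + ennreal (?f (- 1) Z) \<partial>(\<Pi>\<^sub>M i\<in>{..<n}. R))"
    by (intro nn_integral_mono) (auto simp: abs_if simp flip: ennreal_plus intro!: ennreal_leI)
  also have "\<dots> = (\<integral>\<^sup>+Z. ennreal (?f 1 Z) \<partial>(\<Pi>\<^sub>M i\<in>{..<n}. R))
      + (\<integral>\<^sup>+Z. ennreal (?f (- 1) Z) \<partial>(\<Pi>\<^sub>M i\<in>{..<n}. R))"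
    by (rule nn_integral_add) measurable
  also have "\<dots> \<le> ennreal (exp (c\<^sup>2 * B\<^sup>2 / (2 * real n))) + ennreal (exp (c\<^sup>2 * B\<^sup>2 / (2 * real n)))"
    by (intro add_mono le) auto
  also have "\<dots> = ennreal (2 * exp (c\<^sup>2 * B\<^sup>2 / (2 * real n)))"
    by (simp flip: ennreal_plus)
  finally show ?thesis .
qed

section \<open>Loss functions and constants\<close>

lemma ln_three_halves: "ln (3 / 2 :: real) \<ge> 1 / 3"
  using ln_add_one_self_le_self2 ln_diff_le[of 1 "3/2::real"] by simp

text \<open>
  With \<open>p = ln a / ln (3/2)\<close> the doubling condition bounds \<open>l (x w)\<close> by \<open>a x\<^sup>p l w\<close>, and
  \<open>ln x \<le> ln (C\<^sup>2) + x / C\<^sup>2\<close> turns the power into \<open>C\<^sup>2\<^sup>p exp x\<close>, because \<open>C\<^sup>2 \<ge> 3 ln a \<ge> p\<close>.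
\<close>

lemma loss_growth:
  fixes l :: "real \<Rightarrow> real" and a C w x :: real
  assumes l: "l \<in> {0..} \<rightarrow> {0..}" "mono_on {0..} l" and a: "a > 1"
    and growth: "\<And>t. t \<ge> 0 \<Longrightarrow> l (3 / 2 * t) \<le> a * l t"
    and C: "C \<ge> 1" "C\<^sup>2 \<ge> 3 * ln a" and w: "w \<ge> 0" and x: "x \<ge> 0"
  shows "l (x * w) \<le> a powi (\<lceil>2 * ln C / ln (3 / 2)\<rceil> + 1) * exp x * l w"
proof -
  have lw: "l w \<ge> 0" using l(1) w by auto
  have L: "ln (3 / 2 :: real) > 0" "1 \<le> 3 * ln (3 / 2 :: real)" using ln_three_halves by simp_all
  have iter: "l ((3 / 2) ^ k * w) \<le> a ^ k * l w" for k
  proof (induction k)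
    case (Suc k)
    have "l ((3 / 2) ^ Suc k * w) \<le> a * l ((3 / 2) ^ k * w)"
      using growth[of "(3 / 2) ^ k * w"] w by (simp add: mult.assoc)
    also have "\<dots> \<le> a * (a ^ k * l w)" using Suc a by (intro mult_left_mono) auto
    finally show ?case by (simp add: mult.assoc)
  qed simp
  \<comment> \<open>Keeps the logarithm nonnegative, so that \<open>nat\<close> does not truncate
    the ceiling.\<close>
  define y where "y = max 1 x"
  have y: "y \<ge> 1" "y \<ge> x" by (auto simp: y_def)
  define k where "k = nat \<lceil>ln y / ln (3 / 2)\<rceil>"
  have pos: "ln y / ln (3 / 2) \<ge> 0" using y L by simp
  \<comment> \<open>Rounding up costs at most one, which becomes the \<open>+ 1\<close> in the
    exponent of \<open>a\<close>.\<close>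
  have k: "ln y / ln (3 / 2) \<le> real k" "real k \<le> ln y / ln (3 / 2) + 1"
    unfolding k_def using pos by linarith+
  have "ln y \<le> real k * ln (3 / 2)" using k(1) L by (simp add: divide_le_eq)
  then have "exp (ln y) \<le> exp (real k * ln (3 / 2))" by simp
  also have "exp (real k * ln (3 / 2)) = (3 / 2) ^ k" by (simp add: exp_of_nat_mult)
  finally have "x \<le> (3 / 2) ^ k" using y by simp
  then have "l (x * w) \<le> l ((3 / 2) ^ k * w)"
    using x w by (intro mono_onD[OF l(2)] mult_right_mono) auto
  also have "\<dots> \<le> a ^ k * l w" by (rule iter)
  also have "\<dots> \<le> a powi (\<lceil>2 * ln C / ln (3 / 2)\<rceil> + 1) * exp x * l w"
  proof (rule mult_right_mono[OF _ lw])
    have "real k * ln a \<le> of_int (\<lceil>2 * ln C / ln (3 / 2)\<rceil> + 1) * ln a + x"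
    proof (cases "x \<le> 1")
      case True
      then have "k = 0" by (simp add: k_def y_def)
      moreover have "0 \<le> 2 * ln C / ln (3 / 2)" using C L by simp
      then have "0 \<le> of_int (\<lceil>2 * ln C / ln (3 / 2)\<rceil> + 1) * ln a"
        using a by (intro mult_nonneg_nonneg) auto
      ultimately show ?thesis using x by simp
    next
      case False
      then have yx: "y = x" by (simp add: y_def)
      have C2: "C\<^sup>2 > 0" using C by simp
      have "ln x = ln (C\<^sup>2) + ln (x / C\<^sup>2)" using C False by (simp add: ln_div)
      also have "ln (x / C\<^sup>2) \<le> x / C\<^sup>2"
        using ln_le_minus_one[of "x / C\<^sup>2"] False C2 by simp
      also have "ln (C\<^sup>2) = 2 * ln C" using C by (simp add: ln_realpow)
      finally have "ln x / ln (3 / 2) \<le> (2 * ln C + x / C\<^sup>2) / ln (3 / 2)"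
        using L by (intro divide_right_mono) auto
      also have "\<dots> = 2 * ln C / ln (3 / 2) + x / C\<^sup>2 / ln (3 / 2)" by (simp add: add_divide_distrib)
      also have "\<dots> \<le> of_int \<lceil>2 * ln C / ln (3 / 2)\<rceil> + x / C\<^sup>2 / ln (3 / 2)" by simp
      finally have "real k \<le> of_int (\<lceil>2 * ln C / ln (3 / 2)\<rceil> + 1) + x / C\<^sup>2 / ln (3 / 2)"
        using k(2) unfolding yx by simp
      then have "real k * ln a
          \<le> (of_int (\<lceil>2 * ln C / ln (3 / 2)\<rceil> + 1) + x / C\<^sup>2 / ln (3 / 2)) * ln a"
        using a by (intro mult_right_mono) auto
      also have "\<dots> = of_int (\<lceil>2 * ln C / ln (3 / 2)\<rceil> + 1) * ln a + x / C\<^sup>2 / ln (3 / 2) * ln a"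
        by (rule distrib_right)
      also have "x / C\<^sup>2 / ln (3 / 2) * ln a \<le> x"
      proof -
        have "ln a * 1 \<le> ln a * (3 * ln (3 / 2))" using a L by (intro mult_left_mono) auto
        also have "\<dots> \<le> C\<^sup>2 * ln (3 / 2)"
          using mult_right_mono[OF C(2), of "ln (3 / 2)"] L by (simp add: mult_ac)
        finally have "ln a \<le> C\<^sup>2 * ln (3 / 2)" by simp
        then have "x * ln a \<le> x * (C\<^sup>2 * ln (3 / 2))" using x by (rule mult_left_mono)
        then show ?thesis using C2 L by (simp add: field_simps)
      qed
      finally show ?thesis by simp
    qed
    then have "exp (real k * ln a) \<le> exp (of_int (\<lceil>2 * ln C / ln (3 / 2)\<rceil> + 1) * ln a + x)" by simp
    also have "\<dots> = a powr of_int (\<lceil>2 * ln C / ln (3 / 2)\<rceil> + 1) * exp x"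
      using a by (simp add: exp_add powr_def)
    also have "\<dots> = a powi (\<lceil>2 * ln C / ln (3 / 2)\<rceil> + 1) * exp x"
      using a by (subst powr_real_of_int') auto
    also have "exp (real k * ln a) = a ^ k" using a by (simp add: exp_of_nat_mult)
    finally show "a ^ k \<le> a powi (\<lceil>2 * ln C / ln (3 / 2)\<rceil> + 1) * exp x" .
  qed
  finally show ?thesis .
qed

text \<open>Both bounds come from the entry \<open>sqrt (2 * ln (2 * a)) + 1\<close> of the maximum:
  its root scaled by \<open>sqrt (3 / 2)\<close> squares to \<open>3 * ln (2 * a)\<close>.\<close>

lemma C_const_bounds:
  assumes "a > 1"
  shows "C_const \<alpha> a \<ge> 1" "(C_const \<alpha> a)\<^sup>2 \<ge> 3 * ln a"
proof -
  have l: "ln a > 0" "ln (2 * a) \<ge> ln a" using assms by auto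
  define u where "u = sqrt (2 * ln (2 * a))"
  have u: "u \<ge> 0" "u\<^sup>2 = 2 * ln (2 * a)" using l by (auto simp: u_def)
  have s: "sqrt (3 / 2 :: real) \<ge> 1" by simp
  have m: "u + 1 \<le> max (8 * (exp \<alpha> + 1)) (u + 1) + 1" by linarith
  have "1 * (u + 1) \<le> C_const \<alpha> a"
    unfolding C_const_def u_def[symmetric] using s m u by (intro mult_mono) auto
  with u(1) show "C_const \<alpha> a \<ge> 1" by simp
  have "sqrt (3 / 2) * u \<le> C_const \<alpha> a"
    unfolding C_const_def u_def[symmetric] by (intro mult_left_mono) auto
  then have "(sqrt (3 / 2) * u)\<^sup>2 \<le> (C_const \<alpha> a)\<^sup>2" using u by (intro power_mono) auto
  then show "(C_const \<alpha> a)\<^sup>2 \<ge> 3 * ln a" using l u by (simp add: power_mult_distrib)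
qed

text \<open>The left factor \<open>exp 1\<close> pays for the bias and
  \<open>2 * exp (1 / 128)\<close> for the noise. Their product is below 7, while
  \<open>2 * a - 1 \<le> a\<^sup>2\<close> makes the bracket in \<open>C2_const\<close> exceed
  8.\<close>

lemma C2_const_ge:
  assumes "a > 1"
  shows "a powi (\<lceil>2 * ln (C_const \<alpha> a) / ln (3 / 2)\<rceil> + 1) * (exp 1 * (2 * exp (1 / 128)))
    \<le> C2_const \<alpha> a"
proof -
  define N where "N = \<lceil>2 * ln (C_const \<alpha> a) / ln (3 / 2)\<rceil>"
  have "exp (1 / 128 :: real) \<le> 1 + 1 / 128 + (1 / 128)\<^sup>2" by (rule exp_bound) auto
  then have "exp (1 / 128 :: real) \<le> 65 / 64" by (simp add: power2_eq_square)
  moreover have "exp (1::real) \<le> 3" by (rule exp_le)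
  ultimately have "exp 1 * (2 * exp (1 / 128)) \<le> 3 * (2 * (65 / 64 :: real))"
    by (intro mult_mono) auto
  then have e: "exp 1 * (2 * exp (1 / 128)) \<le> (7::real)" by simp
  have "8 * 1 \<le> 8 * a\<^sup>2 / (2 * a - 1)"
  proof -
    have "2 * a - 1 \<le> a\<^sup>2" using zero_le_power2[of "a - 1"] by (simp add: power2_eq_square algebra_simps)
    then show ?thesis using assms by (simp add: le_divide_eq)
  qed
  then have 7: "7 \<le> 2 + a\<^sup>2 + 8 * a\<^sup>2 / (2 * a - 1)"
    using zero_le_power2[of a] by linarith
  have "a powi (N + 1) * (exp 1 * (2 * exp (1 / 128))) \<le> a powi (N + 3) * (2 + a\<^sup>2 + 8 * a\<^sup>2 / (2 * a - 1))"
    using e 7 assms by (intro mult_mono power_int_increasing) auto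
  then show ?thesis by (simp add: C2_const_def N_def mult.commute)
qed

section \<open>The risk bound\<close>

text \<open>At most linear growth beyond \<open>\<epsilon>\<close> means that a modulus vanishing at
  one positive \<open>\<epsilon>\<close> vanishes everywhere.\<close>

lemma (in bounded_linear_functional) constant_of_omega_TV_eq_0:
  assumes "\<epsilon> > 0" "omega_TV \<P> \<theta> \<epsilon> = 0" "P \<in> \<P>" "Q \<in> \<P>"
  shows "\<theta> P = \<theta> Q"
proof (cases "d_TV P Q \<le> \<epsilon>")
  case True
  then show ?thesis using abs_diff_le_omega_TV[OF assms(3,4) True] assms(2) by simp
next
  case False
  then show ?thesis using abs_diff_le_scaled_omega_TV[OF assms(3,4,1)] assms(2) by simp
qed

theorem corollary4p5:
  fixes \<alpha> a :: real and n :: nat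
    and M :: "'a measure" and \<P> :: "'a measure set"
    and \<theta> :: "'a measure \<Rightarrow> real" and l :: "real \<Rightarrow> real"
  assumes "\<alpha> > 0" and "n \<ge> 1"
    and "\<P> \<noteq> {}" and "\<P> \<subseteq> space (prob_algebra M)"
    and "convex_measures \<P>" and "dominated_on M \<P>"
    and "linear_functional_on \<P> \<theta>" and "bounded (\<theta> ` \<P>)"
    and "l \<in> {0..} \<rightarrow> {0..}" and "mono_on {0..} l" and "l 0 = 0"
    and "a > 1" and "\<And>t. t \<ge> 0 \<Longrightarrow> l (3 / 2 * t) \<le> a * l t"
  shows "\<exists>lstar \<in> L_infty M. \<exists>b::real.
    (SUP P\<in>\<P>. \<integral>\<^sup>+Z. ennreal (l \<bar>mean_estimator \<P> \<theta> n b Z - \<theta> P\<bar>)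
        \<partial>(\<Pi>\<^sub>M i\<in>{..<n}. P \<bind> Q1 M \<alpha> lstar))
    \<le> ennreal (C2_const \<alpha> a
        * l (omega_TV \<P> \<theta> (4 / sqrt (real n) * ((exp \<alpha> + 1) / (exp \<alpha> - 1)))))"
proof -
  interpret bounded_linear_functional M \<P> \<theta>
    using assms(3-5,7,8) by unfold_locales
  define \<kappa> where "\<kappa> = (exp \<alpha> + 1) / (exp \<alpha> - 1)"
  define \<epsilon> where "\<epsilon> = 4 / sqrt (real n) * \<kappa>"
  define \<omega> where "\<omega> = omega_TV \<P> \<theta> \<epsilon>"
  have \<kappa>: "\<kappa> > 0" using assms(1) by (simp add: \<kappa>_def add_pos_pos)
  have sqrt_n: "sqrt (real n) > 0" using assms(2) by simp
  have \<epsilon>: "\<epsilon> > 0" using \<kappa> sqrt_n by (simp add: \<epsilon>_def)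
  have \<omega>_nonneg: "\<omega> \<ge> 0" using omega_TV_nonneg[of \<epsilon>] \<epsilon> by (simp add: \<omega>_def)
  have "\<exists>lstar \<in> L_infty M. \<exists>b::real. \<forall>P\<in>\<P>.
      (\<integral>\<^sup>+Z. ennreal (l \<bar>mean_estimator \<P> \<theta> n b Z - \<theta> P\<bar>)
        \<partial>(\<Pi>\<^sub>M i\<in>{..<n}. P \<bind> Q1 M \<alpha> lstar)) \<le> ennreal (C2_const \<alpha> a * l \<omega>)"
  proof (cases "\<omega> = 0")
    case True
    \<comment> \<open>Deviations cannot be measured in units of \<open>\<omega>\<close> here; the
      projection onto a single point gives zero error for every sample.\<close>
    have "mean_estimator \<P> \<theta> n 0 Z = \<theta> P" if P: "P \<in> \<P>" for P Z
    proof -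
      have "\<theta> ` \<P> = {\<theta> P}"
        using constant_of_omega_TV_eq_0[OF \<epsilon> True[unfolded \<omega>_def] _ P] P by blast
      then have "closure (\<theta> ` \<P>) = {\<theta> P}" by simp
      then show ?thesis
        using closest_point_in_set[of "{\<theta> P}"] unfolding mean_estimator_def by simp
    qed
    moreover have "(\<lambda>_. 0) \<in> L_infty M" by (simp add: L_infty_def image_constant_conv)
    ultimately show ?thesis
      using assms(11) by (intro bexI[of _ "\<lambda>_. 0"] exI[of _ 0]) simp_all
  next
    case False
    with \<omega>_nonneg have \<omega>: "\<omega> > 0" by simp
    define K where "K = \<omega> / (2 * \<epsilon>)"
    obtain lstar where meas: "lstar \<in> borel_measurable M" and lstar: "(\<forall>x. \<bar>lstar x\<bar> \<le> K) \<and>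
        (\<exists>b. \<forall>P\<in>\<P>. \<bar>(\<integral>x. lstar x \<partial>P) + b - \<theta> P\<bar> \<le> \<omega>)"
      using near_unbiased_functional[OF assms(6) \<epsilon> \<omega>[unfolded \<omega>_def]] unfolding \<omega>_def K_def by (rule bexE)
    have bound: "\<bar>lstar x\<bar> \<le> K" for x using lstar by (rule conjunct1[THEN spec])
    obtain b where bias: "\<forall>P\<in>\<P>. \<bar>(\<integral>x. lstar x \<partial>P) + b - \<theta> P\<bar> \<le> \<omega>"
      using conjunct2[OF lstar] by (rule exE)
    have L: "lstar \<in> L_infty M"
      using meas bound by (auto simp: L_infty_def bounded_iff)
    obtain P0 where P0: "P0 \<in> \<P>" using nonempty by blast
    \<comment> \<open>Ensures that the real \<open>SUP\<close> in \<open>sup_norm\<close> is a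
      genuine supremum.\<close>
    have "space M \<noteq> {}"
      using prob_space.not_empty[OF prob[OF P0]] sets_eq_imp_space_eq[OF sets_eq[OF P0]] by simp
    then have sup_le: "sup_norm M lstar \<le> K"
      unfolding sup_norm_def by (intro cSUP_least bound)
    from \<open>space M \<noteq> {}\<close> obtain x0 where "x0 \<in> space M" by blast
    from abs_le_sup_norm[OF L this] have sup_ge: "0 \<le> sup_norm M lstar" by linarith
    have z0: "z0 M \<alpha> lstar = sup_norm M lstar * \<kappa>" by (simp add: z0_def \<kappa>_def)
    have "\<bar>z0 M \<alpha> lstar\<bar> \<le> K * \<kappa>"
      unfolding z0 using sup_le sup_ge \<kappa> by (simp add: abs_mult mult_right_mono)
    \<comment> \<open>The channel factor \<open>\<kappa>\<close> cancels against the one in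
      \<open>\<epsilon>\<close>, so the noise level depends only on \<open>\<omega>\<close> and
      \<open>n\<close>.\<close>
    also have "K * \<kappa> = \<omega> * sqrt (real n) / 8"
      using \<kappa> sqrt_n by (simp add: K_def \<epsilon>_def field_simps)
    finally have "\<bar>z0 M \<alpha> lstar\<bar>\<^sup>2 \<le> (\<omega> * sqrt (real n) / 8)\<^sup>2"
      by (rule power_mono) simp
    then have "(1 / \<omega>)\<^sup>2 * \<bar>z0 M \<alpha> lstar\<bar>\<^sup>2 / (2 * real n)
        \<le> (1 / \<omega>)\<^sup>2 * (\<omega> * sqrt (real n) / 8)\<^sup>2 / (2 * real n)"
      by (intro divide_right_mono mult_left_mono) auto
    also have "\<dots> = 1 / 128"
      using \<omega> assms(2) by (simp add: power_mult_distrib power_divide)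
    finally have noise: "(1 / \<omega>)\<^sup>2 * \<bar>z0 M \<alpha> lstar\<bar>\<^sup>2 / (2 * real n) \<le> 1 / 128" .
    define A where "A = a powi (\<lceil>2 * ln (C_const \<alpha> a) / ln (3 / 2)\<rceil> + 1)"
    have A: "A \<ge> 0" using assms(12) by (simp add: A_def)
    have l\<omega>: "l \<omega> \<ge> 0" using assms(9) \<omega> by auto
    have "(\<integral>\<^sup>+Z. ennreal (l \<bar>mean_estimator \<P> \<theta> n b Z - \<theta> P\<bar>)
        \<partial>(\<Pi>\<^sub>M i\<in>{..<n}. P \<bind> Q1 M \<alpha> lstar)) \<le> ennreal (C2_const \<alpha> a * l \<omega>)" if P: "P \<in> \<P>" for P
    proof -
      define R where "R = P \<bind> Q1 M \<alpha> lstar"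
      have P': "P \<in> space (prob_algebra M)" using P assms(4) by blast
      have R: "prob_space R" "sets R = sets borel" "AE z in R. \<bar>z\<bar> \<le> \<bar>z0 M \<alpha> lstar\<bar>"
          "(\<integral>z. z \<partial>R) = (\<integral>x. lstar x \<partial>P)"
        unfolding R_def
        using prob_space_bind_Q1[OF assms(1) L P'] sets_bind_Q1[OF assms(1) L P']
          AE_bind_Q1[OF assms(1) L P'] integral_bind_Q1[OF assms(1) L P'] by auto
      define N where "N Z = \<bar>(\<Sum>i<n. Z i) / real n - (\<integral>z. z \<partial>R)\<bar>" for Z
      have N_meas [measurable]: "N \<in> borel_measurable (\<Pi>\<^sub>M i\<in>{..<n}. R)"
        unfolding N_def[abs_def] using borel_measurable_sample_mean[OF R(2)] by measurable
      have loss: "l \<bar>mean_estimator \<P> \<theta> n b Z - \<theta> P\<bar> \<le> A * exp 1 * l \<omega> * exp (1 / \<omega> * N Z)" for Z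
      proof -
        \<comment> \<open>Total error in units of \<open>\<omega>\<close>: the 1 stands for the
          bias, the second summand for the deviation \<open>N Z\<close>.\<close>
        define x where "x = 1 + 1 / \<omega> * N Z"
        have x: "x \<ge> 0" "x * \<omega> = N Z + \<omega>" using \<omega> by (simp_all add: x_def N_def field_simps)
        have "\<bar>mean_estimator \<P> \<theta> n b Z - \<theta> P\<bar> \<le> \<bar>(\<Sum>i<n. Z i) / real n + b - \<theta> P\<bar>"
          unfolding mean_estimator_def by (rule abs_projection_le[OF P])
        also have "\<dots> \<le> N Z + \<bar>(\<integral>x. lstar x \<partial>P) + b - \<theta> P\<bar>"
          unfolding N_def R(4) by linarith
        also have "\<dots> \<le> x * \<omega>" unfolding x(2) using bspec[OF bias P] by simp
        finally have "l \<bar>mean_estimator \<P> \<theta> n b Z - \<theta> P\<bar> \<le> l (x * \<omega>)"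
          using x(1) \<omega> by (intro mono_onD[OF assms(10)]) auto
        also have "\<dots> \<le> A * exp x * l \<omega>"
          unfolding A_def using \<omega>_nonneg x(1) assms(13)
          by (intro loss_growth assms C_const_bounds)
        also have "\<dots> = A * exp 1 * l \<omega> * exp (1 / \<omega> * N Z)"
          by (simp add: x_def exp_add)
        finally show ?thesis .
      qed
      have "(\<integral>\<^sup>+Z. ennreal (l \<bar>mean_estimator \<P> \<theta> n b Z - \<theta> P\<bar>) \<partial>(\<Pi>\<^sub>M i\<in>{..<n}. R))
          \<le> (\<integral>\<^sup>+Z. ennreal (A * exp 1 * l \<omega>) * ennreal (exp (1 / \<omega> * N Z)) \<partial>(\<Pi>\<^sub>M i\<in>{..<n}. R))"
        using loss A l\<omega> by (intro nn_integral_mono) (simp add: ennreal_leI flip: ennreal_mult)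
      also have "\<dots> = ennreal (A * exp 1 * l \<omega>) * (\<integral>\<^sup>+Z. ennreal (exp (1 / \<omega> * N Z)) \<partial>(\<Pi>\<^sub>M i\<in>{..<n}. R))"
        by (rule nn_integral_cmult) measurable
      also have "\<dots> \<le> ennreal (A * exp 1 * l \<omega>) * ennreal (2 * exp (1 / 128))"
      proof (rule mult_left_mono)
        have "(\<integral>\<^sup>+Z. ennreal (exp (1 / \<omega> * N Z)) \<partial>(\<Pi>\<^sub>M i\<in>{..<n}. R))
            \<le> ennreal (2 * exp ((1 / \<omega>)\<^sup>2 * \<bar>z0 M \<alpha> lstar\<bar>\<^sup>2 / (2 * real n)))"
          unfolding N_def using \<omega> by (intro nn_integral_exp_abs_mean_le R(1-3) assms(2)) simp
        also have "\<dots> \<le> ennreal (2 * exp (1 / 128))"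
          using noise by (intro ennreal_leI) simp
        finally show "(\<integral>\<^sup>+Z. ennreal (exp (1 / \<omega> * N Z)) \<partial>(\<Pi>\<^sub>M i\<in>{..<n}. R))
            \<le> ennreal (2 * exp (1 / 128))" .
      qed simp
      also have "\<dots> = ennreal (A * (exp 1 * (2 * exp (1 / 128))) * l \<omega>)"
        using A l\<omega> by (simp add: mult_ac flip: ennreal_mult)
      also have "\<dots> \<le> ennreal (C2_const \<alpha> a * l \<omega>)"
        using C2_const_ge[OF assms(12), of \<alpha>] l\<omega> unfolding A_def
        by (intro ennreal_leI mult_right_mono)
      finally show ?thesis unfolding R_def .
    qed
    then show ?thesis by (intro bexI[OF _ L] exI[of _ b] ballI)
  qed
  then obtain lstar b where "lstar \<in> L_infty M" and "\<forall>P\<in>\<P>.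
      (\<integral>\<^sup>+Z. ennreal (l \<bar>mean_estimator \<P> \<theta> n b Z - \<theta> P\<bar>)
        \<partial>(\<Pi>\<^sub>M i\<in>{..<n}. P \<bind> Q1 M \<alpha> lstar)) \<le> ennreal (C2_const \<alpha> a * l \<omega>)"
    by blast
  then show ?thesis
    unfolding \<omega>_def \<epsilon>_def \<kappa>_def by (intro bexI[of _ lstar] exI[of _ b] SUP_least) auto
qed

end
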